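(* The only finitely generated almost minimal varieties in the lattice of subvarieties of $K(\mathsf{SRL})$ are $\mathbb V(\mathbf K_4)=K(\mathsf{BA})$ and $\mathbb V(\mathbf K_8)=\mathbb V(K_0(\mathbf 2\oplus\mathbf 2))$.
   Context: $\mathsf{BCRL}$: bounded commutative residuated lattices $(A,\vee,\wedge,\cdot,\to,0,1)$ (lattice, commutative monoid, $ab\le c$ iff $a\le b\to c$, $1$ greatest, $0$ least); $\neg x:=x\to0$. $\mathsf{SRL}$ is the subvariety of Stonean residuated lattices, defined by $\neg x\vee\neg\neg x=1$; $\mathsf{BA}$ is the variety of Boolean algebras. For $\mathbf A\in\mathsf{BCRL}$, $K(\mathbf A)$ is the algebra on $A\times A$ with $(a,b)\vee(c,d)=(a\vee c,b\wedge d)$, $(a,b)\wedge(c,d)=(a\wedge c,b\vee d)$, $(a,b)(c,d)=(ac,(a\to d)\wedge(c\to b))$, $(a,b)\to(c,d)=((a\to c)\wedge(d\to b),ad)$, unit $(1,1)$, constant $0$ as $(0,1)$. With $\sim x:=x\to1$, a bounded K-lattice is a commutative residuated lattice with extra constant $0\le x$ satisfying $\sim\sim x=x$, the lattice distributive laws whenever one of the three elements is $1$, and $xy\wedge 1=(x\wedge1)(y\wedge1)$, $((x\wedge1)\to y)\wedge((\sim y\wedge 1)\to\sim x)=x\to y$. For such $\mathbf A$, $\mathbf A^-$ is the algebra on $\{a\le1\}$ with the same $\vee,\wedge,\cdot,0,1$ and $a\to^-b=(a\to b)\wedge1$; for a subvariety $\mathcal V$ of $\mathsf{BCRL}$, $K(\mathcal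 V)$ is the class of bounded K-lattices $\mathbf A$ with $\mathbf A^-\in\mathcal V$. A subalgebra $\mathbf S$ of a bounded K-lattice $\mathbf A$ is admissible if $S^-=A^-$; $K_0(\mathbf A)$ is the smallest admissible subalgebra of $K(\mathbf A)$. $\mathbf 2$ is the two-element Boolean algebra, $\mathbf K_4=K(\mathbf 2)$, and $\mathbf 2\oplus\mathbf 2$ is the three-element chain $0<c<1$ with $c^2=c$ (the three-element Gödel chain); $\mathbf K_8=K_0(\mathbf 2\oplus\mathbf 2)$, which has universe $K(\mathbf 2\oplus\mathbf2)\setminus\{(0,0)\}$. A variety is almost minimal if it covers an atom of the lattice of subvarieties. *)

theory Defs
  imports "HOL-Algebra.Group"
begin

text \<open>Algebras in the common signature \<open>(\<or>, \<and>, \<cdot>, \<rightarrow>, 0, 1)\<close> of bounded commutative residuated lattices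
  and bounded K-lattices, with an explicit carrier.\<close>

record 'a resl = "'a monoid" +
  rjoin :: "['a, 'a] \<Rightarrow> 'a" (infixl \<open>\<curlyvee>\<index>\<close> 65)
  rmeet :: "['a, 'a] \<Rightarrow> 'a" (infixl \<open>\<curlywedge>\<index>\<close> 67)
  rimp :: "['a, 'a] \<Rightarrow> 'a" (infixr \<open>\<rightharpoonup>\<index>\<close> 63)
  rzero :: 'a (\<open>\<zero>\<index>\<close>)

definition rle :: "[('a, 'm) resl_scheme, 'a, 'a] \<Rightarrow> bool" (infix \<open>\<preceq>\<index>\<close> 50)
  where "x \<preceq>\<^bsub>A\<^esub> y \<longleftrightarrow> x \<curlywedge>\<^bsub>A\<^esub> y = x"

locale resl_algebra =
  fixes A :: "'a resl" (structure)
  assumes join_closed: "\<lbrakk>x \<in> carrier A; y \<in> carrier A\<rbrakk> \<Longrightarrow> x \<curlyvee> y \<in> carrier A"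
    and meet_closed: "\<lbrakk>x \<in> carrier A; y \<in> carrier A\<rbrakk> \<Longrightarrow> x \<curlywedge> y \<in> carrier A"
    and mult_closed: "\<lbrakk>x \<in> carrier A; y \<in> carrier A\<rbrakk> \<Longrightarrow> x \<otimes> y \<in> carrier A"
    and imp_closed: "\<lbrakk>x \<in> carrier A; y \<in> carrier A\<rbrakk> \<Longrightarrow> x \<rightharpoonup> y \<in> carrier A"
    and zero_in_carrier: "\<zero> \<in> carrier A"
    and one_in_carrier: "\<one> \<in> carrier A"

locale comm_res_lattice = resl_algebra A + comm_monoid A for A :: "'a resl" (structure) +
  assumes join_comm: "\<lbrakk>x \<in> carrier A; y \<in> carrier A\<rbrakk> \<Longrightarrow> x \<curlyvee> y = y \<curlyvee> x"
    and meet_comm: "\<lbrakk>x \<in> carrier A; y \<in> carrier A\<rbrakk> \<Longrightarrow> x \<curlywedge> y = y \<curlywedge> x"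
    and join_assoc: "\<lbrakk>x \<in> carrier A; y \<in> carrier A; z \<in> carrier A\<rbrakk>
      \<Longrightarrow> (x \<curlyvee> y) \<curlyvee> z = x \<curlyvee> (y \<curlyvee> z)"
    and meet_assoc: "\<lbrakk>x \<in> carrier A; y \<in> carrier A; z \<in> carrier A\<rbrakk>
      \<Longrightarrow> (x \<curlywedge> y) \<curlywedge> z = x \<curlywedge> (y \<curlywedge> z)"
    and join_absorb: "\<lbrakk>x \<in> carrier A; y \<in> carrier A\<rbrakk> \<Longrightarrow> x \<curlyvee> (x \<curlywedge> y) = x"
    and meet_absorb: "\<lbrakk>x \<in> carrier A; y \<in> carrier A\<rbrakk> \<Longrightarrow> x \<curlywedge> (x \<curlyvee> y) = x"
    and residuation: "\<lbrakk>x \<in> carrier A; y \<in> carrier A; z \<in> carrier A\<rbrakk>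
      \<Longrightarrow> (x \<otimes> y) \<preceq> z \<longleftrightarrow> x \<preceq> (y \<rightharpoonup> z)"

locale bcrl = comm_res_lattice +
  assumes zero_le: "x \<in> carrier A \<Longrightarrow> \<zero> \<preceq> x"
    and le_one: "x \<in> carrier A \<Longrightarrow> x \<preceq> \<one>"

text \<open>Here \<open>\<one>\<close> need not be the greatest element, and \<open>\<sim>x\<close> is \<open>x \<rightharpoonup> \<one>\<close>.\<close>

locale bounded_K_lattice = comm_res_lattice +
  assumes zero_le: "x \<in> carrier A \<Longrightarrow> \<zero> \<preceq> x"
    and involution: "x \<in> carrier A \<Longrightarrow> (x \<rightharpoonup> \<one>) \<rightharpoonup> \<one> = x"
    and distrib_meet: "\<lbrakk>x \<in> carrier A; y \<in> carrier A; z \<in> carrier A; \<one> \<in> {x, y, z}\<rbrakk>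
      \<Longrightarrow> x \<curlywedge> (y \<curlyvee> z) = (x \<curlywedge> y) \<curlyvee> (x \<curlywedge> z)"
    and distrib_join: "\<lbrakk>x \<in> carrier A; y \<in> carrier A; z \<in> carrier A; \<one> \<in> {x, y, z}\<rbrakk>
      \<Longrightarrow> x \<curlyvee> (y \<curlywedge> z) = (x \<curlyvee> y) \<curlywedge> (x \<curlyvee> z)"
    and mult_meet_one: "\<lbrakk>x \<in> carrier A; y \<in> carrier A\<rbrakk>
      \<Longrightarrow> (x \<otimes> y) \<curlywedge> \<one> = (x \<curlywedge> \<one>) \<otimes> (y \<curlywedge> \<one>)"
    and imp_decomp: "\<lbrakk>x \<in> carrier A; y \<in> carrier A\<rbrakk>
      \<Longrightarrow> ((x \<curlywedge> \<one>) \<rightharpoonup> y) \<curlywedge> (((y \<rightharpoonup> \<one>) \<curlywedge> \<one>) \<rightharpoonup> (x \<rightharpoonup> \<one>)) = x \<rightharpoonup> y"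


definition SRL :: "'a resl set"
  where "SRL = {A. bcrl A \<and>
    (\<forall>x\<in>carrier A. (x \<rightharpoonup>\<^bsub>A\<^esub> \<zero>\<^bsub>A\<^esub>) \<curlyvee>\<^bsub>A\<^esub> ((x \<rightharpoonup>\<^bsub>A\<^esub> \<zero>\<^bsub>A\<^esub>) \<rightharpoonup>\<^bsub>A\<^esub> \<zero>\<^bsub>A\<^esub>) = \<one>\<^bsub>A\<^esub>)}"

text \<open>Boolean algebras in the residuated signature: complemented distributive lattices with
  \<open>\<cdot> = \<and>\<close>; the residual is then forced to be \<open>\<not>x \<or> y\<close>.\<close>

definition BA :: "'a resl set"
  where "BA = {A. bcrl A \<and>
    (\<forall>x\<in>carrier A. \<forall>y\<in>carrier A. x \<otimes>\<^bsub>A\<^esub> y = x \<curlywedge>\<^bsub>A\<^esub> y) \<and>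
    (\<forall>x\<in>carrier A. \<forall>y\<in>carrier A. \<forall>z\<in>carrier A.
      x \<curlywedge>\<^bsub>A\<^esub> (y \<curlyvee>\<^bsub>A\<^esub> z) = (x \<curlywedge>\<^bsub>A\<^esub> y) \<curlyvee>\<^bsub>A\<^esub> (x \<curlywedge>\<^bsub>A\<^esub> z)) \<and>
    (\<forall>x\<in>carrier A. \<exists>y\<in>carrier A. x \<curlywedge>\<^bsub>A\<^esub> y = \<zero>\<^bsub>A\<^esub> \<and> x \<curlyvee>\<^bsub>A\<^esub> y = \<one>\<^bsub>A\<^esub>)}"

definition K :: "'a resl \<Rightarrow> ('a \<times> 'a) resl"
  where "K A = \<lparr>carrier = carrier A \<times> carrier A,
    mult = (\<lambda>(a, b) (c, d). (a \<otimes>\<^bsub>A\<^esub> c, (a \<rightharpoonup>\<^bsub>A\<^esub> d) \<curlywedge>\<^bsub>A\<^esub> (c \<rightharpoonup>\<^bsub>A\<^esub> b))),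
    one = (\<one>\<^bsub>A\<^esub>, \<one>\<^bsub>A\<^esub>),
    rjoin = (\<lambda>(a, b) (c, d). (a \<curlyvee>\<^bsub>A\<^esub> c, b \<curlywedge>\<^bsub>A\<^esub> d)),
    rmeet = (\<lambda>(a, b) (c, d). (a \<curlywedge>\<^bsub>A\<^esub> c, b \<curlyvee>\<^bsub>A\<^esub> d)),
    rimp = (\<lambda>(a, b) (c, d). ((a \<rightharpoonup>\<^bsub>A\<^esub> c) \<curlywedge>\<^bsub>A\<^esub> (d \<rightharpoonup>\<^bsub>A\<^esub> b), a \<otimes>\<^bsub>A\<^esub> d)),
    rzero = (\<zero>\<^bsub>A\<^esub>, \<one>\<^bsub>A\<^esub>)\<rparr>"

definition neg_cone :: "'a resl \<Rightarrow> 'a resl"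
  where "neg_cone A = A\<lparr>carrier := {a \<in> carrier A. a \<preceq>\<^bsub>A\<^esub> \<one>\<^bsub>A\<^esub>},
    rimp := (\<lambda>a b. (a \<rightharpoonup>\<^bsub>A\<^esub> b) \<curlywedge>\<^bsub>A\<^esub> \<one>\<^bsub>A\<^esub>)\<rparr>"

definition K_class :: "'a resl set \<Rightarrow> 'a resl set"
  where "K_class V = {A. bounded_K_lattice A \<and> neg_cone A \<in> V}"

definition admissible :: "'a set \<Rightarrow> 'a resl \<Rightarrow> bool"
  where "admissible S A \<longleftrightarrow> S \<subseteq> carrier A \<and> resl_algebra (A\<lparr>carrier := S\<rparr>) \<and>
    neg_cone (A\<lparr>carrier := S\<rparr>) = neg_cone A"

definition K0 :: "'a resl \<Rightarrow> ('a \<times> 'a) resl"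
  where "K0 A = (K A)\<lparr>carrier := \<Inter>{S. admissible S (K A)}\<rparr>"

definition two :: "bool resl"
  where "two = \<lparr>carrier = UNIV, mult = (\<and>), one = True,
    rjoin = (\<or>), rmeet = (\<and>), rimp = (\<longrightarrow>), rzero = False\<rparr>"

text \<open>\<open>\<two> \<oplus> \<two>\<close>, the three-element Goedel chain; its elements \<open>0 < c < 1\<close> are the numbers \<open>0 < 1 < 2\<close>.\<close>

definition two_plus_two :: "nat resl"
  where "two_plus_two = \<lparr>carrier = {0, 1, 2}, mult = min, one = 2,
    rjoin = max, rmeet = min, rimp = (\<lambda>a b. if a \<le> b then 2 else b), rzero = 0\<rparr>"

definition K4 :: "(bool \<times> bool) resl"
  where "K4 = K two"

definition K8 :: "(nat \<times> nat) resl"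
  where "K8 = K0 two_plus_two"


datatype rterm = Var nat | Join rterm rterm | Meet rterm rterm | Mult rterm rterm
  | Imp rterm rterm | Zero | One

primrec eval :: "'a resl \<Rightarrow> (nat \<Rightarrow> 'a) \<Rightarrow> rterm \<Rightarrow> 'a"
  where
    "eval A \<rho> (Var n) = \<rho> n"
  | "eval A \<rho> (Join s t) = eval A \<rho> s \<curlyvee>\<^bsub>A\<^esub> eval A \<rho> t"
  | "eval A \<rho> (Meet s t) = eval A \<rho> s \<curlywedge>\<^bsub>A\<^esub> eval A \<rho> t"
  | "eval A \<rho> (Mult s t) = eval A \<rho> s \<otimes>\<^bsub>A\<^esub> eval A \<rho> t"
  | "eval A \<rho> (Imp s t) = eval A \<rho> s \<rightharpoonup>\<^bsub>A\<^esub> eval A \<rho> t"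
  | "eval A \<rho> Zero = \<zero>\<^bsub>A\<^esub>"
  | "eval A \<rho> One = \<one>\<^bsub>A\<^esub>"

definition satisfies :: "'a resl \<Rightarrow> rterm \<times> rterm \<Rightarrow> bool"
  where "satisfies A e \<longleftrightarrow>
    (\<forall>\<rho>. range \<rho> \<subseteq> carrier A \<longrightarrow> eval A \<rho> (fst e) = eval A \<rho> (snd e))"

definition Mod :: "(rterm \<times> rterm) set \<Rightarrow> 'a resl set"
  where "Mod E = {A. resl_algebra A \<and> (\<forall>e\<in>E. satisfies A e)}"

definition Th :: "'a resl set \<Rightarrow> (rterm \<times> rterm) set"
  where "Th C = {e. \<forall>A\<in>C. satisfies A e}"

text \<open>A variety is an equational class. HOL has no proper classes, so all members have carriers
  inside one type \<open>'a\<close>. If \<open>'a\<close> is infinite, the countably generated free algebras fit into it, and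
  inclusion between such classes agrees with inclusion between the varieties they stand for.\<close>

definition variety :: "'a resl set \<Rightarrow> bool"
  where "variety V \<longleftrightarrow> (\<exists>E. V = Mod E)"

text \<open>The generators may live on a type other than \<open>'a\<close>; when they do not, \<open>\<V>\<close> is the least
  variety containing them (\<open>gen_variety_least\<close> below).\<close>

definition gen_variety :: "'b resl set \<Rightarrow> 'a resl set" (\<open>\<V>\<close>)
  where "\<V> C = Mod (Th C)"

lemma gen_variety_least:
  fixes C :: "'a resl set"
  assumes "\<And>A. A \<in> C \<Longrightarrow> resl_algebra A"
  shows "variety (\<V> C :: 'a resl set)" "C \<subseteq> \<V> C"
    "\<lbrakk>variety V; C \<subseteq> V\<rbrakk> \<Longrightarrow> \<V> C \<subseteq> V"
proof -
  show "variety (\<V> C :: 'a resl set)"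
    by (auto simp: gen_variety_def variety_def)
  show "C \<subseteq> \<V> C"
    using assms by (auto simp: gen_variety_def Mod_def Th_def)
  show "\<V> C \<subseteq> V" if V: "variety V" and C: "C \<subseteq> V"
  proof -
    obtain E where E: "V = Mod E"
      using V unfolding variety_def by blast
    have "E \<subseteq> Th C"
      using C unfolding E Mod_def Th_def by blast
    then show ?thesis
      unfolding E gen_variety_def Mod_def by blast
  qed
qed

definition finitely_generated :: "'a resl set \<Rightarrow> bool"
  where "finitely_generated V \<longleftrightarrow> (\<exists>C :: 'a resl set. finite C \<and>
    (\<forall>A\<in>C. resl_algebra A \<and> finite (carrier A)) \<and> V = \<V> C)"

definition subvarieties :: "'a resl set \<Rightarrow> 'a resl set set"
  where "subvarieties W = {V. variety V \<and> V \<subseteq> W}"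

definition covers :: "'b set set \<Rightarrow> 'b set \<Rightarrow> 'b set \<Rightarrow> bool"
  where "covers L V U \<longleftrightarrow> U \<in> L \<and> V \<in> L \<and> U \<subset> V \<and> \<not> (\<exists>X\<in>L. U \<subset> X \<and> X \<subset> V)"

definition atom :: "'b set set \<Rightarrow> 'b set \<Rightarrow> bool"
  where "atom L V \<longleftrightarrow> (\<exists>B\<in>L. (\<forall>X\<in>L. B \<subseteq> X) \<and> covers L V B)"

definition almost_minimal :: "'b set set \<Rightarrow> 'b set \<Rightarrow> bool"
  where "almost_minimal L V \<longleftrightarrow> (\<exists>U. atom L U \<and> covers L V U)"

end

theory Submission
  imports Defs
begin

text \<open>
  A nontrivial bounded K-lattice contains the three-element algebra \<open>K3\<close> of its constants, so \<open>\<V> {K3}\<close>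
  is the unique atom. Let \<open>A\<close> be a finite member of \<open>K(SRL)\<close> with negative cone \<open>R\<close>; the twist map
  \<open>x \<mapsto> (x \<and> 1, \<sim>x \<and> 1)\<close> embeds \<open>A\<close> into \<open>K(R)\<close>. If \<open>x \<or> \<not>x = 1\<close> holds in \<open>R\<close>, then \<open>R\<close> is Boolean, the
  homomorphisms \<open>R \<rightarrow> \<two>\<close> make \<open>A\<close> a subdirect product of subalgebras of \<open>K4\<close>, and these are \<open>K3\<close> and
  \<open>K4\<close>. Otherwise some \<open>d = x \<or> \<not>x \<noteq> 1\<close> satisfies \<open>\<not>d = 0\<close> by the Stonean law; a minimal such element
  \<open>c\<close> is idempotent, \<open>{0, c, 1}\<close> is a copy of \<open>\<two> \<oplus> \<two>\<close> in \<open>R\<close>, and \<open>K8\<close> embeds in \<open>A\<close>. Hence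
  \<open>A \<in> \<V> {K3}\<close>, or \<open>\<V> {A}\<close> contains \<open>K4\<close> or \<open>K8\<close>. As \<open>\<V> {K4}\<close> and \<open>\<V> {K8}\<close> are locally finite and
  incomparable, both cover \<open>\<V> {K3}\<close>, and no other finitely generated variety does.
\<close>

section \<open>Equational logic\<close>

definition resl_hom :: "'a resl \<Rightarrow> 'b resl \<Rightarrow> ('a \<Rightarrow> 'b) \<Rightarrow> bool"
  where "resl_hom A B f \<longleftrightarrow> f ` carrier A \<subseteq> carrier B \<and>
    (\<forall>x\<in>carrier A. \<forall>y\<in>carrier A.
      f (x \<curlyvee>\<^bsub>A\<^esub> y) = f x \<curlyvee>\<^bsub>B\<^esub> f y \<and> f (x \<curlywedge>\<^bsub>A\<^esub> y) = f x \<curlywedge>\<^bsub>B\<^esub> f y \<and>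
      f (x \<otimes>\<^bsub>A\<^esub> y) = f x \<otimes>\<^bsub>B\<^esub> f y \<and> f (x \<rightharpoonup>\<^bsub>A\<^esub> y) = f x \<rightharpoonup>\<^bsub>B\<^esub> f y) \<and>
    f \<zero>\<^bsub>A\<^esub> = \<zero>\<^bsub>B\<^esub> \<and> f \<one>\<^bsub>A\<^esub> = \<one>\<^bsub>B\<^esub>"

lemma (in resl_algebra) eval_closed: "range \<rho> \<subseteq> carrier A \<Longrightarrow> eval A \<rho> t \<in> carrier A"
  by (induction t)
    (auto simp: join_closed meet_closed mult_closed imp_closed zero_in_carrier one_in_carrier)

lemma eval_hom:
  assumes "resl_algebra A" "resl_hom A B f" "range \<rho> \<subseteq> carrier A"
  shows "f (eval A \<rho> t) = eval B (f \<circ> \<rho>) t"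
  using assms(2)
  by (induction t) (auto simp: resl_hom_def resl_algebra.eval_closed[OF assms(1,3)])

lemma resl_hom_comp:
  "\<lbrakk>resl_hom A B f; resl_hom B C g\<rbrakk> \<Longrightarrow> resl_hom A C (g \<circ> f)"
  by (auto simp: resl_hom_def image_subset_iff)

lemma resl_hom_id: "resl_hom A A id"
  by (simp add: resl_hom_def)

lemma resl_hom_subalgebra:
  "\<lbrakk>resl_hom A B f; S \<subseteq> carrier A\<rbrakk> \<Longrightarrow> resl_hom (A\<lparr>carrier := S\<rparr>) B f"
  by (auto simp: resl_hom_def image_subset_iff subset_iff)

text \<open>Identities pass to subalgebras of homomorphic images: \<open>B\<close> embeds by
  \<open>g\<close> into the image of \<open>f\<close>, so an assignment in \<open>B\<close> lifts to
  one in \<open>A\<close> with the same values in \<open>C\<close>. Comparing inside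
  \<open>C\<close> avoids forming quotients.\<close>

lemma Th_mono_hom:
  assumes "resl_algebra A" "resl_algebra B"
    and f: "resl_hom A C f" and g: "resl_hom B C g" "inj_on g (carrier B)"
    and sub: "g ` carrier B \<subseteq> f ` carrier A"
  shows "Th {A} \<subseteq> Th {B}"
proof
  fix e assume e: "e \<in> Th {A}"
  show "e \<in> Th {B}"
    unfolding Th_def satisfies_def
  proof clarsimp
    fix \<rho> :: "nat \<Rightarrow> _" assume \<rho>: "range \<rho> \<subseteq> carrier B"
    have "\<forall>n. \<exists>a. a \<in> carrier A \<and> f a = g (\<rho> n)"
      using sub \<rho> by (metis imageE image_subset_iff rangeI)
    then obtain \<sigma> where \<sigma>: "\<And>n. \<sigma> n \<in> carrier A" "\<And>n. f (\<sigma> n) = g (\<rho> n)"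
      by metis
    then have *: "f \<circ> \<sigma> = g \<circ> \<rho>" "range \<sigma> \<subseteq> carrier A"
      by auto
    have "eval A \<sigma> (fst e) = eval A \<sigma> (snd e)"
      using e *(2) by (auto simp: Th_def satisfies_def)
    then have "g (eval B \<rho> (fst e)) = g (eval B \<rho> (snd e))"
      using eval_hom[OF assms(1) f *(2)] eval_hom[OF assms(2) g(1) \<rho>] *(1) by metis
    then show "eval B \<rho> (fst e) = eval B \<rho> (snd e)"
      using g(2) resl_algebra.eval_closed[OF assms(2) \<rho>] by (auto dest: inj_onD)
  qed
qed

lemma Th_mono_subalgebra:
  assumes "resl_algebra A" "resl_algebra (A\<lparr>carrier := S\<rparr>)" "S \<subseteq> carrier A"
  shows "Th {A} \<subseteq> Th {A\<lparr>carrier := S\<rparr>}"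
  using Th_mono_hom[OF assms(1,2) resl_hom_id resl_hom_subalgebra[OF resl_hom_id assms(3)]] assms(3)
  by simp

text \<open>Separating homomorphisms embed \<open>A\<close> in a power of \<open>B\<close>, where
  identities hold coordinatewise.\<close>

lemma Th_mono_subdirect:
  assumes "resl_algebra A"
    and sep: "\<And>x y. \<lbrakk>x \<in> carrier A; y \<in> carrier A; x \<noteq> y\<rbrakk> \<Longrightarrow> \<exists>f. resl_hom A B f \<and> f x \<noteq> f y"
  shows "Th {B} \<subseteq> Th {A}"
proof
  fix e assume e: "e \<in> Th {B}"
  show "e \<in> Th {A}"
    unfolding Th_def satisfies_def
  proof clarsimp
    fix \<rho> :: "nat \<Rightarrow> _" assume \<rho>: "range \<rho> \<subseteq> carrier A"
    have "f (eval A \<rho> (fst e)) = f (eval A \<rho> (snd e))" if f: "resl_hom A B f" for f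
    proof -
      have "range (f \<circ> \<rho>) \<subseteq> carrier B"
        using f \<rho> by (auto simp: resl_hom_def image_subset_iff)
      then show ?thesis
        using e eval_hom[OF assms(1) f \<rho>] by (auto simp: Th_def satisfies_def)
    qed
    then show "eval A \<rho> (fst e) = eval A \<rho> (snd e)"
      using sep resl_algebra.eval_closed[OF assms(1) \<rho>] by blast
  qed
qed

text \<open>Moves \<open>K3\<close>, \<open>K4\<close> and \<open>K8\<close>, which live on types of
  their own, into the type that carries the varieties.\<close>

lemma Th_isomorphic_copy:
  fixes A :: "'b resl"
  assumes A: "resl_algebra A" and fin: "finite (carrier A)" and inf: "infinite (UNIV :: 'a set)"
  obtains B :: "'a resl" where "resl_algebra B" "finite (carrier B)" "Th {B} = Th {A}"
proof -
  obtain T :: "'a set" where "finite T" "card T = card (carrier A)"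
    using infinite_arbitrarily_large[OF inf] by blast
  then obtain f where "bij_betw f (carrier A) T"
    using finite_same_card_bij[OF fin] by metis
  then have f: "inj_on f (carrier A)"
    by (rule bij_betw_imp_inj_on)
  define g where "g = inv_into (carrier A) f"
  have gf: "\<And>x. x \<in> carrier A \<Longrightarrow> g (f x) = x"
    unfolding g_def using f by simp
  define B where "B = \<lparr>carrier = f ` carrier A, mult = (\<lambda>x y. f (g x \<otimes>\<^bsub>A\<^esub> g y)), one = f \<one>\<^bsub>A\<^esub>,
    rjoin = (\<lambda>x y. f (g x \<curlyvee>\<^bsub>A\<^esub> g y)), rmeet = (\<lambda>x y. f (g x \<curlywedge>\<^bsub>A\<^esub> g y)),
    rimp = (\<lambda>x y. f (g x \<rightharpoonup>\<^bsub>A\<^esub> g y)), rzero = f \<zero>\<^bsub>A\<^esub>\<rparr>"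
  interpret resl_algebra A by fact
  have B: "resl_algebra B"
    by unfold_locales
      (auto simp: B_def gf join_closed meet_closed mult_closed imp_closed zero_in_carrier one_in_carrier)
  have hom: "resl_hom A B f"
    by (auto simp: resl_hom_def B_def gf)
  have "Th {A} \<subseteq> Th {B}"
    by (rule Th_mono_hom[OF A B hom resl_hom_id]) (auto simp: B_def)
  moreover have "Th {B} \<subseteq> Th {A}"
    by (rule Th_mono_hom[OF B A resl_hom_id hom f]) (auto simp: B_def)
  ultimately show ?thesis
    using that B fin by (auto simp: B_def)
qed

section \<open>Term functions and local finiteness\<close>

primrec vars :: "rterm \<Rightarrow> nat set"
  where
    "vars (Var n) = {n}"
  | "vars (Join s t) = vars s \<union> vars t"
  | "vars (Meet s t) = vars s \<union> vars t"
  | "vars (Mult s t) = vars s \<union> vars t"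
  | "vars (Imp s t) = vars s \<union> vars t"
  | "vars Zero = {}"
  | "vars One = {}"

lemma finite_vars: "finite (vars t)"
  by (induction t) auto

lemma eval_cong: "(\<And>n. n \<in> vars t \<Longrightarrow> \<rho> n = \<sigma> n) \<Longrightarrow> eval A \<rho> t = eval A \<sigma> t"
  by (induction t) auto

lemma eval_carrier_update [simp]: "eval (A\<lparr>carrier := S\<rparr>) \<rho> t = eval A \<rho> t"
  by (induction t) auto

text \<open>Elements of a subalgebra generated by finitely many elements are represented by the term
  functions that the terms induce on the finite algebra \<open>B\<close>, so there are only finitely many.\<close>

lemma finite_refuting_subalgebra:
  assumes A: "resl_algebra A" and B: "resl_algebra B" "finite (carrier B)" and AB: "Th {B} \<subseteq> Th {A}"
    and e: "e \<notin> Th {A}"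
  obtains S where "S \<subseteq> carrier A" "finite S" "resl_algebra (A\<lparr>carrier := S\<rparr>)"
    "e \<notin> Th {A\<lparr>carrier := S\<rparr>}"
proof -
  obtain \<rho> where \<rho>: "range \<rho> \<subseteq> carrier A" and ne: "eval A \<rho> (fst e) \<noteq> eval A \<rho> (snd e)"
    using e by (auto simp: Th_def satisfies_def)
  define X where "X = vars (fst e) \<union> vars (snd e)"
  have finX: "finite X"
    by (simp add: X_def finite_vars)
  define T where "T = {t. vars t \<subseteq> X}"
  define S where "S = eval A \<rho> ` T"
  have one: "\<one>\<^bsub>B\<^esub> \<in> carrier B"
    by (rule resl_algebra.one_in_carrier[OF B(1)])
  \<comment> \<open>Assignments are total, so those on \<open>X\<close> are padded with the unit;
    \<open>F t\<close> is the term function of \<open>t\<close> over \<open>B\<close> in the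
    variables \<open>X\<close>, an element of a finite function space.\<close>
  define pad where "pad = (\<lambda>(\<tau> :: nat \<Rightarrow> _) n. if n \<in> X then \<tau> n else \<one>\<^bsub>B\<^esub>)"
  define F where "F = (\<lambda>t. restrict (\<lambda>\<tau>. eval B (pad \<tau>) t) (PiE X (\<lambda>_. carrier B)))"
  have pad: "range (pad \<tau>) \<subseteq> carrier B" if "\<tau> \<in> PiE X (\<lambda>_. carrier B)" for \<tau>
    using that one by (auto simp: pad_def)
  have "F ` T \<subseteq> PiE (PiE X (\<lambda>_. carrier B)) (\<lambda>_. carrier B)"
    using resl_algebra.eval_closed[OF B(1) pad] unfolding F_def image_subset_iff restrict_PiE_iff by blast
  moreover have "finite (PiE (PiE X (\<lambda>_. carrier B)) (\<lambda>_. carrier B))"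
    using finX B(2) by (intro finite_PiE) auto
  ultimately have finF: "finite (F ` T)"
    by (rule finite_subset)
  \<comment> \<open>Equal term functions make \<open>(s, t)\<close> an identity of \<open>B\<close>,
    hence of \<open>A\<close>; so the value of a term under \<open>\<rho>\<close> depends only on
    its term function.\<close>
  have same: "eval A \<rho> s = eval A \<rho> t" if st: "s \<in> T" "t \<in> T" "F s = F t" for s t
  proof -
    have "(s, t) \<in> Th {B}"
      unfolding Th_def satisfies_def
    proof clarsimp
      fix \<tau> :: "nat \<Rightarrow> _" assume \<tau>: "range \<tau> \<subseteq> carrier B"
      have r: "restrict \<tau> X \<in> PiE X (\<lambda>_. carrier B)"
        using \<tau> by auto
      have eq: "eval B (pad (restrict \<tau> X)) u = eval B \<tau> u" if "u \<in> T" for u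
        by (rule eval_cong) (use that in \<open>auto simp: T_def pad_def\<close>)
      have "F s (restrict \<tau> X) = F t (restrict \<tau> X)"
        using st(3) by simp
      then show "eval B \<tau> s = eval B \<tau> t"
        using r eq st(1,2) by (simp add: F_def)
    qed
    then have "(s, t) \<in> Th {A}"
      using AB by blast
    then show ?thesis
      using \<rho> by (simp add: Th_def satisfies_def)
  qed
  have "S \<subseteq> (\<lambda>v. eval A \<rho> (inv_into T F v)) ` F ` T"
  proof
    fix a assume "a \<in> S"
    then obtain t where t: "t \<in> T" "a = eval A \<rho> t"
      by (auto simp: S_def)
    have "eval A \<rho> (inv_into T F (F t)) = a"
      unfolding t(2) using t(1) by (intro same) (auto intro: inv_into_into f_inv_into_f)
    then show "a \<in> (\<lambda>v. eval A \<rho> (inv_into T F v)) ` F ` T"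
      using t(1) by blast
  qed
  then have "finite S"
    using finF finite_subset by blast
  moreover have sub: "S \<subseteq> carrier A"
    using resl_algebra.eval_closed[OF A \<rho>] by (auto simp: S_def)
  moreover have alg: "resl_algebra (A\<lparr>carrier := S\<rparr>)"
  proof -
    have op: "f (eval A \<rho> s) (eval A \<rho> t) \<in> S"
      if "\<And>s t. f (eval A \<rho> s) (eval A \<rho> t) = eval A \<rho> (c s t)" "\<And>s t. vars (c s t) = vars s \<union> vars t"
        "s \<in> T" "t \<in> T" for f c s t
      using that by (auto simp: S_def T_def)
    have *: "eval A \<rho> Zero \<in> S" "eval A \<rho> One \<in> S"
      unfolding S_def by (rule imageI, simp add: T_def)+
    show ?thesis
      using op[of "rjoin A" Join] op[of "rmeet A" Meet] op[of "mult A" Mult] op[of "rimp A" Imp] *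
      by unfold_locales (auto simp: S_def)
  qed
  moreover have "e \<notin> Th {A\<lparr>carrier := S\<rparr>}"
  proof -
    \<comment> \<open>\<open>\<rho>\<close> may leave \<open>S\<close> on variables outside
      \<open>X\<close>; these are sent to the unit, which changes neither side of
      \<open>e\<close>.\<close>
    define \<sigma> where "\<sigma> = (\<lambda>n. if n \<in> X then \<rho> n else \<one>\<^bsub>A\<^esub>)"
    have "\<rho> n \<in> S" if "n \<in> X" for n
      unfolding S_def by (rule image_eqI[of _ _ "Var n"]) (use that in \<open>auto simp: T_def\<close>)
    moreover have "\<one>\<^bsub>A\<^esub> \<in> S"
      using resl_algebra.one_in_carrier[OF alg] by simp
    ultimately have "range \<sigma> \<subseteq> S"
      by (auto simp: \<sigma>_def)
    moreover have "eval A \<sigma> (fst e) = eval A \<rho> (fst e)" "eval A \<sigma> (snd e) = eval A \<rho> (snd e)"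
      by (rule eval_cong; simp add: \<sigma>_def X_def)+
    ultimately show ?thesis
      using ne by (auto simp: Th_def satisfies_def intro!: exI[of _ \<sigma>])
  qed
  ultimately show ?thesis
    using that by blast
qed

section \<open>Residuated lattices and the twist construction\<close>

context comm_res_lattice
begin

lemmas closed [simp] =
  join_closed meet_closed mult_closed imp_closed zero_in_carrier one_in_carrier

lemma meet_idem: "x \<in> carrier A \<Longrightarrow> x \<curlywedge> x = x"
  by (metis closed(2) join_absorb meet_absorb)

lemma le_refl: "x \<in> carrier A \<Longrightarrow> x \<preceq> x"
  by (simp add: rle_def meet_idem)

lemma le_antisym: "\<lbrakk>x \<preceq> y; y \<preceq> x; x \<in> carrier A; y \<in> carrier A\<rbrakk> \<Longrightarrow> x = y"
  unfolding rle_def by (metis meet_comm)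

lemma le_trans: "\<lbrakk>x \<preceq> y; y \<preceq> z; x \<in> carrier A; y \<in> carrier A; z \<in> carrier A\<rbrakk> \<Longrightarrow> x \<preceq> z"
  unfolding rle_def by (metis meet_assoc)

lemma le_iff_join: "\<lbrakk>x \<in> carrier A; y \<in> carrier A\<rbrakk> \<Longrightarrow> x \<preceq> y \<longleftrightarrow> x \<curlyvee> y = y"
  unfolding rle_def by (metis join_absorb join_comm meet_absorb meet_comm)

lemma meet_le1: "\<lbrakk>x \<in> carrier A; y \<in> carrier A\<rbrakk> \<Longrightarrow> x \<curlywedge> y \<preceq> x"
  unfolding rle_def by (metis closed(2) meet_assoc meet_comm meet_idem)

lemma meet_le2: "\<lbrakk>x \<in> carrier A; y \<in> carrier A\<rbrakk> \<Longrightarrow> x \<curlywedge> y \<preceq> y"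
  using meet_le1[of y x] by (simp add: meet_comm)

lemma meet_greatest:
  "\<lbrakk>z \<preceq> x; z \<preceq> y; x \<in> carrier A; y \<in> carrier A; z \<in> carrier A\<rbrakk> \<Longrightarrow> z \<preceq> x \<curlywedge> y"
  unfolding rle_def by (metis meet_assoc)

lemma join_ge1: "\<lbrakk>x \<in> carrier A; y \<in> carrier A\<rbrakk> \<Longrightarrow> x \<preceq> x \<curlyvee> y"
  by (simp add: rle_def meet_absorb)

lemma join_ge2: "\<lbrakk>x \<in> carrier A; y \<in> carrier A\<rbrakk> \<Longrightarrow> y \<preceq> x \<curlyvee> y"
  using join_ge1[of y x] by (simp add: join_comm)

lemma join_least:
  "\<lbrakk>x \<preceq> z; y \<preceq> z; x \<in> carrier A; y \<in> carrier A; z \<in> carrier A\<rbrakk> \<Longrightarrow> x \<curlyvee> y \<preceq> z"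
  by (simp add: le_iff_join join_assoc)

lemma le_meet_iff:
  "\<lbrakk>x \<in> carrier A; y \<in> carrier A; z \<in> carrier A\<rbrakk> \<Longrightarrow> z \<preceq> x \<curlywedge> y \<longleftrightarrow> z \<preceq> x \<and> z \<preceq> y"
  by (meson le_trans meet_closed meet_greatest meet_le1 meet_le2)

lemma join_le_iff:
  "\<lbrakk>x \<in> carrier A; y \<in> carrier A; z \<in> carrier A\<rbrakk> \<Longrightarrow> x \<curlyvee> y \<preceq> z \<longleftrightarrow> x \<preceq> z \<and> y \<preceq> z"
  by (meson le_trans join_closed join_least join_ge1 join_ge2)

text \<open>Identities between residuals are proved by comparing lower (dually upper) bounds, a form
  in which \<open>residuation\<close> applies directly.\<close>

lemma eq_by_lower:
  assumes "\<And>w. w \<in> carrier A \<Longrightarrow> w \<preceq> x \<longleftrightarrow> w \<preceq> y" "x \<in> carrier A" "y \<in> carrier A"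
  shows "x = y"
  using assms le_antisym le_refl by blast

lemma eq_by_upper:
  assumes "\<And>w. w \<in> carrier A \<Longrightarrow> x \<preceq> w \<longleftrightarrow> y \<preceq> w" "x \<in> carrier A" "y \<in> carrier A"
  shows "x = y"
  using assms le_antisym le_refl by blast

lemma mult_mono:
  "\<lbrakk>x \<preceq> y; x \<in> carrier A; y \<in> carrier A; z \<in> carrier A\<rbrakk> \<Longrightarrow> x \<otimes> z \<preceq> y \<otimes> z"
  by (meson closed le_refl le_trans residuation)

text \<open>Multiplication by \<open>z\<close> is a left adjoint, hence preserves joins.\<close>

lemma mult_join:
  assumes "x \<in> carrier A" "y \<in> carrier A" "z \<in> carrier A"
  shows "(x \<curlyvee> y) \<otimes> z = (x \<otimes> z) \<curlyvee> (y \<otimes> z)"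
  by (rule eq_by_upper) (use assms in \<open>simp_all add: residuation join_le_iff\<close>)

lemma imp_elim: "\<lbrakk>y \<in> carrier A; z \<in> carrier A\<rbrakk> \<Longrightarrow> (y \<rightharpoonup> z) \<otimes> y \<preceq> z"
  by (simp add: residuation le_refl)

lemma imp_curry:
  assumes "x \<in> carrier A" "y \<in> carrier A" "z \<in> carrier A"
  shows "(x \<otimes> y) \<rightharpoonup> z = x \<rightharpoonup> (y \<rightharpoonup> z)"
  by (rule eq_by_lower) (use assms in \<open>simp_all add: residuation[symmetric] m_assoc\<close>)

lemma one_imp:
  assumes "x \<in> carrier A"
  shows "\<one> \<rightharpoonup> x = x"
  by (rule eq_by_lower) (use assms in \<open>simp_all add: residuation[symmetric]\<close>)

lemma join_imp:
  assumes "x \<in> carrier A" "y \<in> carrier A" "z \<in> carrier A"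
  shows "(x \<curlyvee> y) \<rightharpoonup> z = (x \<rightharpoonup> z) \<curlywedge> (y \<rightharpoonup> z)"
proof (rule eq_by_lower)
  fix w assume w: "w \<in> carrier A"
  have "w \<preceq> (x \<curlyvee> y) \<rightharpoonup> z \<longleftrightarrow> (x \<curlyvee> y) \<otimes> w \<preceq> z"
    using assms w by (simp add: residuation[symmetric] m_comm)
  also have "\<dots> \<longleftrightarrow> x \<otimes> w \<preceq> z \<and> y \<otimes> w \<preceq> z"
    using assms w by (simp add: mult_join join_le_iff)
  also have "\<dots> \<longleftrightarrow> w \<preceq> (x \<rightharpoonup> z) \<curlywedge> (y \<rightharpoonup> z)"
    using assms w by (simp add: residuation[symmetric] le_meet_iff m_comm[of w])
  finally show "w \<preceq> (x \<curlyvee> y) \<rightharpoonup> z \<longleftrightarrow> w \<preceq> (x \<rightharpoonup> z) \<curlywedge> (y \<rightharpoonup> z)" .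
qed (use assms in simp_all)

end

section \<open>The negative cone and the twist map\<close>

lemma neg_cone_simps [simp]:
  "carrier (neg_cone A) = {a \<in> carrier A. a \<preceq>\<^bsub>A\<^esub> \<one>\<^bsub>A\<^esub>}"
  "x \<otimes>\<^bsub>neg_cone A\<^esub> y = x \<otimes>\<^bsub>A\<^esub> y"
  "\<one>\<^bsub>neg_cone A\<^esub> = \<one>\<^bsub>A\<^esub>"
  "x \<curlyvee>\<^bsub>neg_cone A\<^esub> y = x \<curlyvee>\<^bsub>A\<^esub> y"
  "x \<curlywedge>\<^bsub>neg_cone A\<^esub> y = x \<curlywedge>\<^bsub>A\<^esub> y"
  "x \<rightharpoonup>\<^bsub>neg_cone A\<^esub> y = (x \<rightharpoonup>\<^bsub>A\<^esub> y) \<curlywedge>\<^bsub>A\<^esub> \<one>\<^bsub>A\<^esub>"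
  "\<zero>\<^bsub>neg_cone A\<^esub> = \<zero>\<^bsub>A\<^esub>"
  "x \<preceq>\<^bsub>neg_cone A\<^esub> y \<longleftrightarrow> x \<preceq>\<^bsub>A\<^esub> y"
  by (simp_all add: neg_cone_def rle_def)

definition twist :: "'a resl \<Rightarrow> 'a \<Rightarrow> 'a \<times> 'a"
  where "twist A x = (x \<curlywedge>\<^bsub>A\<^esub> \<one>\<^bsub>A\<^esub>, (x \<rightharpoonup>\<^bsub>A\<^esub> \<one>\<^bsub>A\<^esub>) \<curlywedge>\<^bsub>A\<^esub> \<one>\<^bsub>A\<^esub>)"

context bounded_K_lattice
begin

lemma mult_le_one:
  assumes "x \<preceq> \<one>" "y \<preceq> \<one>" "x \<in> carrier A" "y \<in> carrier A"
  shows "x \<otimes> y \<preceq> \<one>"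
  using mult_mono[of x \<one> y] le_trans[of "x \<otimes> y" y \<one>] assms by simp

lemma bcrl_neg_cone: "bcrl (neg_cone A)"
proof unfold_locales
  fix x y assume xy: "x \<in> carrier (neg_cone A)" "y \<in> carrier (neg_cone A)"
  then show "x \<curlyvee>\<^bsub>neg_cone A\<^esub> y \<in> carrier (neg_cone A)"
    by (simp add: join_least)
  show "x \<curlywedge>\<^bsub>neg_cone A\<^esub> y \<in> carrier (neg_cone A)"
    using xy le_trans[OF meet_le1, of x y \<one>] by simp
  show "x \<otimes>\<^bsub>neg_cone A\<^esub> y \<in> carrier (neg_cone A)"
    using xy mult_le_one by simp
  show "x \<rightharpoonup>\<^bsub>neg_cone A\<^esub> y \<in> carrier (neg_cone A)"
    using xy by (simp add: meet_le2)
next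
  fix x y z assume "x \<in> carrier (neg_cone A)" "y \<in> carrier (neg_cone A)" "z \<in> carrier (neg_cone A)"
  then show "x \<otimes>\<^bsub>neg_cone A\<^esub> y \<preceq>\<^bsub>neg_cone A\<^esub> z \<longleftrightarrow> x \<preceq>\<^bsub>neg_cone A\<^esub> y \<rightharpoonup>\<^bsub>neg_cone A\<^esub> z"
    by (simp add: residuation le_meet_iff)
qed (auto simp: zero_le le_refl m_assoc join_assoc meet_assoc join_absorb meet_absorb
    intro: m_comm join_comm meet_comm)

text \<open>For \<open>w\<close> and \<open>u\<close> below the unit, \<open>w \<otimes> u\<close>
  is below it too, so truncating the target at the unit imposes no further condition on
  \<open>w\<close>.\<close>

lemma imp_meet_one:
  assumes "u \<in> carrier A" "u \<preceq> \<one>" "v \<in> carrier A"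
  shows "(u \<rightharpoonup> (v \<curlywedge> \<one>)) \<curlywedge> \<one> = (u \<rightharpoonup> v) \<curlywedge> \<one>"
proof (rule eq_by_lower)
  fix w assume "w \<in> carrier A"
  then show "w \<preceq> (u \<rightharpoonup> (v \<curlywedge> \<one>)) \<curlywedge> \<one> \<longleftrightarrow> w \<preceq> (u \<rightharpoonup> v) \<curlywedge> \<one>"
    using assms mult_le_one by (auto simp: le_meet_iff residuation[symmetric])
qed (use assms in simp_all)

lemma join_meet_one:
  assumes "x \<in> carrier A" "y \<in> carrier A"
  shows "(x \<curlyvee> y) \<curlywedge> \<one> = (x \<curlywedge> \<one>) \<curlyvee> (y \<curlywedge> \<one>)"
  using distrib_meet[of \<one> x y] assms by (simp add: meet_comm)

lemma meet_meet_one: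
  assumes "x \<in> carrier A" "y \<in> carrier A"
  shows "(x \<curlywedge> y) \<curlywedge> \<one> = (x \<curlywedge> \<one>) \<curlywedge> (y \<curlywedge> \<one>)"
  by (rule eq_by_lower) (use assms in \<open>auto simp: le_meet_iff\<close>)

text \<open>The involution carries De Morgan's law for joins, an instance of
  \<open>join_imp\<close>, over to meets.\<close>

lemma neg_meet:
  assumes "x \<in> carrier A" "y \<in> carrier A"
  shows "(x \<curlywedge> y) \<rightharpoonup> \<one> = (x \<rightharpoonup> \<one>) \<curlyvee> (y \<rightharpoonup> \<one>)"
proof -
  have "x \<curlywedge> y = ((x \<rightharpoonup> \<one>) \<curlyvee> (y \<rightharpoonup> \<one>)) \<rightharpoonup> \<one>"
    using assms by (simp add: join_imp involution)
  then show ?thesis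
    using assms by (simp add: involution)
qed

lemma neg_mult:
  assumes "x \<in> carrier A" "y \<in> carrier A"
  shows "((x \<otimes> y) \<rightharpoonup> \<one>) = x \<rightharpoonup> (y \<rightharpoonup> \<one>)"
  using assms by (rule imp_curry) simp

lemma neg_imp:
  assumes "x \<in> carrier A" "y \<in> carrier A"
  shows "(x \<rightharpoonup> y) \<rightharpoonup> \<one> = x \<otimes> (y \<rightharpoonup> \<one>)"
  using assms neg_mult[of x "y \<rightharpoonup> \<one>"] by (metis closed(3,4,6) involution)

text \<open>This is \<open>imp_decomp\<close> truncated at the unit. The right-hand side is the
  first coordinate of the residual in \<open>K (neg_cone A)\<close> at the twists of
  \<open>x\<close> and \<open>y\<close>.\<close>

lemma imp_meet_one_decomp:
  assumes "x \<in> carrier A" "y \<in> carrier A"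
  shows "(x \<rightharpoonup> y) \<curlywedge> \<one> =
    (((x \<curlywedge> \<one>) \<rightharpoonup> (y \<curlywedge> \<one>)) \<curlywedge> \<one>) \<curlywedge> ((((y \<rightharpoonup> \<one>) \<curlywedge> \<one>) \<rightharpoonup> ((x \<rightharpoonup> \<one>) \<curlywedge> \<one>)) \<curlywedge> \<one>)"
  using assms imp_decomp[of x y]
    meet_meet_one[of "(x \<curlywedge> \<one>) \<rightharpoonup> y" "((y \<rightharpoonup> \<one>) \<curlywedge> \<one>) \<rightharpoonup> (x \<rightharpoonup> \<one>)"]
  by (simp add: imp_meet_one meet_le2)

lemma twist_hom: "resl_hom A (K (neg_cone A)) (twist A)"
  unfolding resl_hom_def
proof (intro conjI ballI)
  show "twist A ` carrier A \<subseteq> carrier (K (neg_cone A))"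
    by (auto simp: twist_def K_def meet_le2)
  show "twist A \<zero> = \<zero>\<^bsub>K (neg_cone A)\<^esub>"
  proof -
    have "\<zero> \<preceq> \<one>" "\<one> \<preceq> \<zero> \<rightharpoonup> \<one>"
      by (simp_all add: residuation[symmetric] zero_le)
    then have "\<zero> \<curlywedge> \<one> = \<zero>" "(\<zero> \<rightharpoonup> \<one>) \<curlywedge> \<one> = \<one>"
      by (simp_all add: rle_def meet_comm[of _ \<one>])
    then show ?thesis
      by (simp add: twist_def K_def)
  qed
  show "twist A \<one> = \<one>\<^bsub>K (neg_cone A)\<^esub>"
    by (simp add: twist_def K_def one_imp meet_idem)
next
  fix x y assume xy: "x \<in> carrier A" "y \<in> carrier A"
  show "twist A (x \<curlyvee> y) = twist A x \<curlyvee>\<^bsub>K (neg_cone A)\<^esub> twist A y"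
    using xy by (simp add: twist_def K_def join_meet_one join_imp meet_meet_one)
  show "twist A (x \<curlywedge> y) = twist A x \<curlywedge>\<^bsub>K (neg_cone A)\<^esub> twist A y"
    using xy by (simp add: twist_def K_def join_meet_one neg_meet meet_meet_one)
  \<comment> \<open>By \<open>neg_mult\<close> the second coordinate of the left side is \<open>(x
    \<rightharpoonup> (y \<rightharpoonup> \<one>)) \<curlywedge> \<one>\<close>, hence the
    decomposition at the negation of \<open>y\<close>.\<close>
  show "twist A (x \<otimes> y) = twist A x \<otimes>\<^bsub>K (neg_cone A)\<^esub> twist A y"
    using xy imp_meet_one_decomp[of x "y \<rightharpoonup> \<one>"]
    by (simp add: twist_def K_def neg_mult mult_meet_one involution)
  show "twist A (x \<rightharpoonup> y) = twist A x \<rightharpoonup>\<^bsub>K (neg_cone A)\<^esub> twist A y"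
    using xy imp_meet_one_decomp[of x y]
    by (simp add: twist_def K_def neg_imp mult_meet_one)
qed

lemma twist_neg: "x \<in> carrier A \<Longrightarrow> twist A (x \<rightharpoonup> \<one>) = prod.swap (twist A x)"
  by (simp add: twist_def involution)

lemma neg_meet_one:
  assumes "x \<in> carrier A"
  shows "((x \<rightharpoonup> \<one>) \<curlywedge> \<one>) \<rightharpoonup> \<one> = x \<curlyvee> \<one>"
  using assms by (simp add: neg_meet involution one_imp)

text \<open>The first coordinate is \<open>x \<curlywedge> \<one>\<close>, the second determines
  \<open>x \<curlyvee> \<one>\<close> by \<open>neg_meet_one\<close>, and distributivity at the unit
  recovers \<open>x\<close> from these two.\<close>

lemma twist_inj: "inj_on (twist A) (carrier A)"
proof (rule inj_onI)
  fix x y assume xy: "x \<in> carrier A" "y \<in> carrier A" and eq: "twist A x = twist A y"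
  have m: "x \<curlywedge> \<one> = y \<curlywedge> \<one>"
    using eq by (simp add: twist_def)
  have j: "x \<curlyvee> \<one> = y \<curlyvee> \<one>"
    using eq neg_meet_one[OF xy(1)] neg_meet_one[OF xy(2)] by (simp add: twist_def)
  have "x = x \<curlywedge> (y \<curlyvee> \<one>)"
    using xy j meet_absorb[of x \<one>] by simp
  also have "\<dots> = (y \<curlywedge> x) \<curlyvee> (y \<curlywedge> \<one>)"
    using xy m distrib_meet[of x y \<one>] by (simp add: meet_comm)
  also have "\<dots> = y \<curlywedge> (x \<curlyvee> \<one>)"
    using xy distrib_meet[of y x \<one>] by simp
  also have "\<dots> = y"
    using xy j meet_absorb[of y \<one>] by simp
  finally show "x = y" .
qed

end

lemma K_hom:
  assumes R: "resl_algebra R" and h: "resl_hom R S h"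
  shows "resl_hom (K R) (K S) (map_prod h h)"
proof -
  interpret resl_algebra R by fact
  show ?thesis
    using h by (auto simp: resl_hom_def K_def image_subset_iff imp_closed)
qed

lemma resl_algebra_K: "resl_algebra R \<Longrightarrow> resl_algebra (K R)"
  unfolding resl_algebra_def by (auto simp: K_def)

section \<open>Boolean and Stonean negative cones\<close>

lemma (in comm_res_lattice) zero_mult:
  assumes "\<And>y. y \<in> carrier A \<Longrightarrow> \<zero> \<preceq> y" "x \<in> carrier A"
  shows "\<zero> \<otimes> x = \<zero>"
  by (rule le_antisym) (use assms in \<open>simp_all add: residuation\<close>)

context bcrl
begin

lemma mult_le1: "\<lbrakk>x \<in> carrier A; y \<in> carrier A\<rbrakk> \<Longrightarrow> x \<otimes> y \<preceq> x"
  using mult_mono[of y \<one> x] le_one[of y] by (simp add: m_comm)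

lemma mult_le2: "\<lbrakk>x \<in> carrier A; y \<in> carrier A\<rbrakk> \<Longrightarrow> x \<otimes> y \<preceq> y"
  using mult_le1[of y x] by (simp add: m_comm)

lemma bound_simps:
  assumes "x \<in> carrier A"
  shows "\<zero> \<curlywedge> x = \<zero>" "x \<curlywedge> \<zero> = \<zero>" "\<zero> \<curlyvee> x = x" "x \<curlyvee> \<zero> = x"
    "\<one> \<curlywedge> x = x" "x \<curlywedge> \<one> = x" "\<one> \<curlyvee> x = \<one>" "x \<curlyvee> \<one> = \<one>" "x \<curlywedge> x = x" "x \<curlyvee> x = x"
    "\<zero> \<otimes> x = \<zero>" "x \<otimes> \<zero> = \<zero>"
proof -
  show *: "\<zero> \<curlywedge> x = \<zero>" "x \<curlywedge> \<one> = x" "\<zero> \<curlyvee> x = x" "x \<curlyvee> \<one> = \<one>" "x \<curlywedge> x = x" "x \<curlyvee> x = x"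
      "\<zero> \<otimes> x = \<zero>"
    using assms zero_le[of x] le_one[of x] le_refl[of x]
    by (simp_all add: rle_def le_iff_join[symmetric] zero_mult[OF zero_le])
  show "x \<curlywedge> \<zero> = \<zero>" "\<one> \<curlywedge> x = x" "x \<curlyvee> \<zero> = x" "\<one> \<curlyvee> x = \<one>" "x \<otimes> \<zero> = \<zero>"
    using * assms meet_comm[of x \<zero>] meet_comm[of \<one> x] join_comm[of x \<zero>] join_comm[of \<one> x]
      m_comm[of x \<zero>] by simp_all
qed

lemma imp_eq_one:
  assumes "x \<preceq> y" "x \<in> carrier A" "y \<in> carrier A"
  shows "x \<rightharpoonup> y = \<one>"
  by (rule le_antisym) (use assms in \<open>simp_all add: le_one residuation[symmetric]\<close>)

lemma le_zero_iff: "x \<in> carrier A \<Longrightarrow> x \<preceq> \<zero> \<longleftrightarrow> x = \<zero>"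
  using le_antisym[of x \<zero>] zero_le[of x] le_refl[of \<zero>] by auto

lemma one_le_iff: "x \<in> carrier A \<Longrightarrow> \<one> \<preceq> x \<longleftrightarrow> x = \<one>"
  using le_antisym[of x \<one>] le_one[of x] le_refl[of \<one>] by auto

text \<open>Multiplying the meet by \<open>x \<or> \<not>x\<close>, which is the unit, splits it
  into two products, each below \<open>x \<otimes> \<not>x = \<zero>\<close>.\<close>

lemma meet_neg_eq_zero:
  assumes x: "x \<in> carrier A" and em: "x \<curlyvee> (x \<rightharpoonup> \<zero>) = \<one>"
  shows "x \<curlywedge> (x \<rightharpoonup> \<zero>) = \<zero>"
proof -
  let ?n = "x \<rightharpoonup> \<zero>"
  have n: "?n \<in> carrier A" and xn: "x \<otimes> ?n = \<zero>"
    using x imp_elim[of x \<zero>] by (simp_all add: le_zero_iff m_comm)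
  have "x \<curlywedge> ?n = (x \<curlyvee> ?n) \<otimes> (x \<curlywedge> ?n)"
    using x em by simp
  also have "\<dots> = (x \<otimes> (x \<curlywedge> ?n)) \<curlyvee> (?n \<otimes> (x \<curlywedge> ?n))"
    using x by (simp add: mult_join)
  also have "x \<otimes> (x \<curlywedge> ?n) = \<zero>"
    using mult_mono[OF meet_le2[OF x n], of x] x xn by (simp add: m_comm le_zero_iff)
  also have "?n \<otimes> (x \<curlywedge> ?n) = \<zero>"
    using mult_mono[OF meet_le1[OF x n], of ?n] x xn by (simp add: m_comm le_zero_iff)
  finally show ?thesis
    by (simp add: bound_simps)
qed

text \<open>The point is that product and meet coincide: multiplying \<open>x \<and> y\<close> by
  \<open>x \<or> \<not>x\<close> splits it, the summand from \<open>\<not>x\<close> vanishes, and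
  the other is below \<open>x \<otimes> y\<close>. Distributivity is then that of the product over
  joins, and \<open>\<not>x\<close> is a complement.\<close>

lemma BA_if_excluded_middle:
  assumes em: "\<And>x. x \<in> carrier A \<Longrightarrow> x \<curlyvee> (x \<rightharpoonup> \<zero>) = \<one>"
  shows "A \<in> BA"
proof -
  have mm: "x \<otimes> y = x \<curlywedge> y" if xy: "x \<in> carrier A" "y \<in> carrier A" for x y
  proof (rule le_antisym)
    show "x \<otimes> y \<preceq> x \<curlywedge> y"
      using xy by (simp add: meet_greatest mult_le1 mult_le2)
    let ?m = "x \<curlywedge> y" and ?n = "x \<rightharpoonup> \<zero>"
    have "?n \<otimes> ?m \<preceq> ?n \<otimes> x"
      using mult_mono[OF meet_le1[OF xy], of ?n] xy by (simp add: m_comm)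
    also have "?n \<otimes> x = \<zero>"
      using imp_elim[of x \<zero>] xy by (simp add: le_zero_iff)
    finally have n0: "?n \<otimes> ?m = \<zero>"
      using xy by (simp add: le_zero_iff)
    have "?m = (x \<curlyvee> ?n) \<otimes> ?m"
      using xy em by simp
    also have "\<dots> = x \<otimes> ?m"
      using xy n0 by (simp add: mult_join bound_simps)
    also have "\<dots> \<preceq> x \<otimes> y"
      using mult_mono[OF meet_le2[OF xy], of x] xy by (simp add: m_comm)
    finally show "?m \<preceq> x \<otimes> y" .
  qed (use xy in simp_all)
  have "x \<curlywedge> (y \<curlyvee> z) = (x \<curlywedge> y) \<curlyvee> (x \<curlywedge> z)"
    if "x \<in> carrier A" "y \<in> carrier A" "z \<in> carrier A" for x y z
    using mult_join[of y z x] that by (simp add: mm meet_comm)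
  moreover have "\<exists>y\<in>carrier A. x \<curlywedge> y = \<zero> \<and> x \<curlyvee> y = \<one>" if "x \<in> carrier A" for x
    using that em[OF that] meet_neg_eq_zero[OF that]
    by (intro bexI[of _ "x \<rightharpoonup> \<zero>"]) auto
  moreover have "bcrl A"
    by unfold_locales
  ultimately show ?thesis
    using mm by (simp add: BA_def)
qed

lemma two_hom: "resl_hom two A (\<lambda>b. if b then \<one> else \<zero>)"
  by (auto simp: resl_hom_def two_def bound_simps imp_eq_one one_imp zero_le le_refl)

text \<open>Idempotence and density of \<open>c\<close> are the two table entries of the chain that
  the order and the bounds do not force.\<close>

lemma two_plus_two_hom:
  assumes c: "c \<in> carrier A" "c \<otimes> c = c" "c \<rightharpoonup> \<zero> = \<zero>"
  shows "resl_hom two_plus_two A (\<lambda>n. if n = 0 then \<zero> else if n = 1 then c else \<one>)"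
  using c by (auto simp: resl_hom_def two_plus_two_def bound_simps imp_eq_one one_imp zero_le le_refl
      le_one)

text \<open>A minimal dense element other than the unit is idempotent, because the square of a dense
  element is dense.\<close>

lemma idempotent_dense:
  assumes fin: "finite (carrier A)" and d: "d \<in> carrier A" "d \<noteq> \<one>" "d \<rightharpoonup> \<zero> = \<zero>"
  obtains c where "c \<in> carrier A" "c \<noteq> \<one>" "c \<otimes> c = c" "c \<rightharpoonup> \<zero> = \<zero>"
proof -
  define D where "D = (\<lambda>x. x \<in> carrier A \<and> x \<noteq> \<one> \<and> x \<rightharpoonup> \<zero> = \<zero>)"
  \<comment> \<open>The size of the down-set serves as a rank: an element below \<open>c\<close> of
    the same rank has the same down-set, so a dense element of least rank is minimal.\<close>
  define down where "down = (\<lambda>x. {y \<in> carrier A. y \<preceq> x})"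
  obtain c where c: "D c" and min: "\<And>x. D x \<Longrightarrow> card (down c) \<le> card (down x)"
    using ex_has_least_nat[of D d "card \<circ> down"] d by (auto simp: D_def)
  have cA: "c \<in> carrier A" "c \<noteq> \<one>" "c \<rightharpoonup> \<zero> = \<zero>"
    using c by (simp_all add: D_def)
  have le: "c \<otimes> c \<preceq> c"
    using cA by (simp add: mult_le1)
  have "c \<otimes> c \<noteq> \<one>"
    using le cA by (auto simp: one_le_iff)
  \<comment> \<open>Currying gives \<open>(c \<otimes> c) \<rightharpoonup> \<zero> = c
    \<rightharpoonup> (c \<rightharpoonup> \<zero>) = \<zero>\<close>.\<close>
  then have "D (c \<otimes> c)"
    using cA by (simp add: D_def imp_curry)
  then have "card (down c) \<le> card (down (c \<otimes> c))"
    by (rule min)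
  moreover have "down (c \<otimes> c) \<subseteq> down c"
    using le cA le_trans by (auto simp: down_def)
  moreover have "finite (down c)"
    using fin by (simp add: down_def)
  ultimately have "down (c \<otimes> c) = down c"
    by (simp add: card_seteq)
  then have "c \<preceq> c \<otimes> c"
    using cA le_refl[of c] by (auto simp: down_def)
  then have "c \<otimes> c = c"
    using le cA by (simp add: le_antisym)
  then show ?thesis
    using that cA by blast
qed

text \<open>The negation of \<open>x \<or> \<not>x\<close> is
  \<open>\<not>x \<and> \<not>\<not>x\<close>. The Stonean law is the excluded middle for
  \<open>\<not>x\<close>, so this meet vanishes.\<close>

lemma dense_if_not_excluded_middle:
  assumes st: "\<And>x. x \<in> carrier A \<Longrightarrow> (x \<rightharpoonup> \<zero>) \<curlyvee> ((x \<rightharpoonup> \<zero>) \<rightharpoonup> \<zero>) = \<one>" and x: "x \<in> carrier A"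
  shows "(x \<curlyvee> (x \<rightharpoonup> \<zero>)) \<rightharpoonup> \<zero> = \<zero>"
  using st[OF x] x meet_neg_eq_zero[of "x \<rightharpoonup> \<zero>"] by (simp add: join_imp)

end

text \<open>The maximal filters provided by Zorn's lemma are prime.\<close>

lemma BA_separation:
  assumes R: "R \<in> BA" and xy: "x \<in> carrier R" "y \<in> carrier R" "x \<noteq> y"
  shows "\<exists>h. resl_hom R two h \<and> h x \<noteq> h y"
proof -
  interpret bcrl R
    using R by (simp add: BA_def)
  have mm: "\<And>u v. \<lbrakk>u \<in> carrier R; v \<in> carrier R\<rbrakk> \<Longrightarrow> u \<otimes>\<^bsub>R\<^esub> v = u \<curlywedge>\<^bsub>R\<^esub> v"
    using R by (simp add: BA_def)
  have dist: "\<And>u v w. \<lbrakk>u \<in> carrier R; v \<in> carrier R; w \<in> carrier R\<rbrakk> \<Longrightarrow>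
      u \<curlywedge>\<^bsub>R\<^esub> (v \<curlyvee>\<^bsub>R\<^esub> w) = (u \<curlywedge>\<^bsub>R\<^esub> v) \<curlyvee>\<^bsub>R\<^esub> (u \<curlywedge>\<^bsub>R\<^esub> w)"
    using R by (simp add: BA_def)
  have "\<forall>u\<in>carrier R. \<exists>v. v \<in> carrier R \<and> u \<curlywedge>\<^bsub>R\<^esub> v = \<zero>\<^bsub>R\<^esub> \<and> u \<curlyvee>\<^bsub>R\<^esub> v = \<one>\<^bsub>R\<^esub>"
    using R by (auto simp: BA_def)
  then obtain cp where cp: "\<And>u. u \<in> carrier R \<Longrightarrow> cp u \<in> carrier R"
      "\<And>u. u \<in> carrier R \<Longrightarrow> u \<curlywedge>\<^bsub>R\<^esub> cp u = \<zero>\<^bsub>R\<^esub>"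
      "\<And>u. u \<in> carrier R \<Longrightarrow> u \<curlyvee>\<^bsub>R\<^esub> cp u = \<one>\<^bsub>R\<^esub>"
    by metis
  have le_cp: "v \<preceq>\<^bsub>R\<^esub> w" if "v \<in> carrier R" "w \<in> carrier R" "v \<curlywedge>\<^bsub>R\<^esub> cp w = \<zero>\<^bsub>R\<^esub>" for v w
  proof -
    have "v \<curlywedge>\<^bsub>R\<^esub> w = (v \<curlywedge>\<^bsub>R\<^esub> w) \<curlyvee>\<^bsub>R\<^esub> (v \<curlywedge>\<^bsub>R\<^esub> cp w)"
      using that cp(1) by (simp add: bound_simps)
    also have "\<dots> = v \<curlywedge>\<^bsub>R\<^esub> (w \<curlyvee>\<^bsub>R\<^esub> cp w)"
      using that cp(1) by (simp add: dist)
    also have "\<dots> = v"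
      using that cp(1,3) by (simp add: bound_simps)
    finally show ?thesis
      by (simp add: rle_def)
  qed
  have le_cp': "v \<preceq>\<^bsub>R\<^esub> cp w" if "v \<in> carrier R" "w \<in> carrier R" "v \<curlywedge>\<^bsub>R\<^esub> w = \<zero>\<^bsub>R\<^esub>" for v w
  proof -
    have "v \<curlywedge>\<^bsub>R\<^esub> cp w = (v \<curlywedge>\<^bsub>R\<^esub> w) \<curlyvee>\<^bsub>R\<^esub> (v \<curlywedge>\<^bsub>R\<^esub> cp w)"
      using that cp(1) by (simp add: bound_simps)
    also have "\<dots> = v \<curlywedge>\<^bsub>R\<^esub> (w \<curlyvee>\<^bsub>R\<^esub> cp w)"
      using that cp(1) by (simp add: dist)
    also have "\<dots> = v"
      using that cp(1,3) by (simp add: bound_simps)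
    finally show ?thesis
      by (simp add: rle_def)
  qed
  \<comment> \<open>One-sided form, to be applied to whichever of the two inequalities
    fails.\<close>
  have *: "\<exists>h. resl_hom R two h \<and> h x \<and> \<not> h y"
    if x: "x \<in> carrier R" and y: "y \<in> carrier R" and nle: "\<not> x \<preceq>\<^bsub>R\<^esub> y" for x y
  proof -
    let ?a = "x \<curlywedge>\<^bsub>R\<^esub> cp y"
    \<comment> \<open>Proper filters containing \<open>x \<and> cp y\<close>, which is nonzero
      because \<open>x\<close> is not below \<open>y\<close>. Any of them contains \<open>x\<close>
      and omits \<open>y\<close>.\<close>
    define filt where "filt = (\<lambda>F. F \<subseteq> carrier R \<and> ?a \<in> F \<and> \<zero>\<^bsub>R\<^esub> \<notin> F \<and>
      (\<forall>u\<in>F. \<forall>v\<in>F. u \<curlywedge>\<^bsub>R\<^esub> v \<in> F) \<and> (\<forall>u\<in>F. \<forall>v\<in>carrier R. u \<preceq>\<^bsub>R\<^esub> v \<longrightarrow> v \<in> F))"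
    have a: "?a \<in> carrier R" "?a \<noteq> \<zero>\<^bsub>R\<^esub>"
      using x y cp le_cp nle by auto
    have "filt {v \<in> carrier R. ?a \<preceq>\<^bsub>R\<^esub> v}"
      using a le_trans by (auto simp: filt_def le_refl le_zero_iff meet_greatest)
    moreover have "filt (\<Union> C)" if C: "C \<noteq> {}" "subset.chain (Collect filt) C" for C
    proof -
      have f: "filt F" if "F \<in> C" for F
        using C(2) that by (auto simp: subset.chain_def)
      have "u \<curlywedge>\<^bsub>R\<^esub> v \<in> \<Union> C" if uv: "u \<in> \<Union> C" "v \<in> \<Union> C" for u v
      proof -
        obtain F G where FG: "F \<in> C" "G \<in> C" "u \<in> F" "v \<in> G"
          using uv by blast
        have "F \<subseteq> G \<or> G \<subseteq> F"
          using C(2) FG(1,2) by (auto simp: subset_chain_def)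
        then obtain H where H: "H \<in> C" "u \<in> H" "v \<in> H"
          using FG by blast
        then have "u \<curlywedge>\<^bsub>R\<^esub> v \<in> H"
          using f[OF H(1)] by (simp add: filt_def)
        then show ?thesis
          using H(1) by blast
      qed
      moreover have "\<Union> C \<subseteq> carrier R" "\<zero>\<^bsub>R\<^esub> \<notin> \<Union> C"
        using f unfolding filt_def by blast+
      moreover have "?a \<in> \<Union> C"
        using f C(1) unfolding filt_def by blast
      moreover have "v \<in> \<Union> C" if uv: "u \<in> \<Union> C" "v \<in> carrier R" "u \<preceq>\<^bsub>R\<^esub> v" for u v
      proof -
        obtain H where H: "H \<in> C" "u \<in> H"
          using uv(1) by blast
        then have "v \<in> H"
          using f[OF H(1)] uv(2,3) by (simp add: filt_def)
        then show ?thesis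
          using H(1) by blast
      qed
      ultimately show ?thesis
        unfolding filt_def by blast
    qed
    ultimately have "\<exists>F\<in>Collect filt. \<forall>G\<in>Collect filt. F \<subseteq> G \<longrightarrow> G = F"
      by (intro subset_Zorn_nonempty) auto
    then obtain F where F: "filt F" and max: "\<And>G. \<lbrakk>filt G; F \<subseteq> G\<rbrakk> \<Longrightarrow> G = F"
      by blast
    have FR: "F \<subseteq> carrier R" and aF: "?a \<in> F" and zF: "\<zero>\<^bsub>R\<^esub> \<notin> F"
      and Fm: "\<And>u v. \<lbrakk>u \<in> F; v \<in> F\<rbrakk> \<Longrightarrow> u \<curlywedge>\<^bsub>R\<^esub> v \<in> F"
      and Fu: "\<And>u v. \<lbrakk>u \<in> F; v \<in> carrier R; u \<preceq>\<^bsub>R\<^esub> v\<rbrakk> \<Longrightarrow> v \<in> F"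
      using F by (auto simp: filt_def)
    have prime: "cp u \<in> F" if u: "u \<in> carrier R" "u \<notin> F" for u
    proof -
      \<comment> \<open>\<open>G\<close> is the filter generated by \<open>F\<close> and
        \<open>u\<close>. By maximality of \<open>F\<close> it is improper, which yields
        \<open>f\<close> in \<open>F\<close> disjoint from \<open>u\<close>, so \<open>f\<close> is
        below \<open>cp u\<close>.\<close>
      define G where "G = {v \<in> carrier R. \<exists>f\<in>F. f \<curlywedge>\<^bsub>R\<^esub> u \<preceq>\<^bsub>R\<^esub> v}"
      have FG: "F \<subseteq> G"
        using FR u meet_le1 by (auto simp: G_def)
      moreover have "u \<in> G"
        using FR u aF meet_le2[OF a(1) u(1)] by (auto simp: G_def)
      ultimately have "\<not> filt G"
        using max u(2) by blast
      moreover have "v \<curlywedge>\<^bsub>R\<^esub> w \<in> G" if vw: "v \<in> G" "w \<in> G" for v w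
      proof -
        obtain f g where fg: "f \<in> F" "g \<in> F" "f \<curlywedge>\<^bsub>R\<^esub> u \<preceq>\<^bsub>R\<^esub> v" "g \<curlywedge>\<^bsub>R\<^esub> u \<preceq>\<^bsub>R\<^esub> w"
          and vw': "v \<in> carrier R" "w \<in> carrier R"
          using vw by (auto simp: G_def)
        have c: "f \<in> carrier R" "g \<in> carrier R"
          using fg FR by auto
        have "(f \<curlywedge>\<^bsub>R\<^esub> g) \<curlywedge>\<^bsub>R\<^esub> u \<preceq>\<^bsub>R\<^esub> f \<curlywedge>\<^bsub>R\<^esub> u" "(f \<curlywedge>\<^bsub>R\<^esub> g) \<curlywedge>\<^bsub>R\<^esub> u \<preceq>\<^bsub>R\<^esub> g \<curlywedge>\<^bsub>R\<^esub> u"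
          using c u le_refl[of "(f \<curlywedge>\<^bsub>R\<^esub> g) \<curlywedge>\<^bsub>R\<^esub> u"] by (simp_all add: le_meet_iff)
        from le_trans[OF this(1) fg(3)] le_trans[OF this(2) fg(4)]
        have "(f \<curlywedge>\<^bsub>R\<^esub> g) \<curlywedge>\<^bsub>R\<^esub> u \<preceq>\<^bsub>R\<^esub> v \<curlywedge>\<^bsub>R\<^esub> w"
          using c u vw' by (simp add: meet_greatest)
        then show ?thesis
          using Fm[OF fg(1,2)] vw' by (auto simp: G_def)
      qed
      moreover have "w \<in> G" if vw: "v \<in> G" "w \<in> carrier R" "v \<preceq>\<^bsub>R\<^esub> w" for v w
      proof -
        obtain f where f: "f \<in> F" "f \<curlywedge>\<^bsub>R\<^esub> u \<preceq>\<^bsub>R\<^esub> v" "v \<in> carrier R"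
          using vw by (auto simp: G_def)
        then have "f \<curlywedge>\<^bsub>R\<^esub> u \<preceq>\<^bsub>R\<^esub> w"
          using vw u FR le_trans[of "f \<curlywedge>\<^bsub>R\<^esub> u" v w] by auto
        then show ?thesis
          using f vw by (auto simp: G_def)
      qed
      moreover have "?a \<in> G" "G \<subseteq> carrier R"
        using FG aF by (auto simp: G_def)
      ultimately have "\<zero>\<^bsub>R\<^esub> \<in> G"
        unfolding filt_def by blast
      then obtain f where f: "f \<in> F" "f \<curlywedge>\<^bsub>R\<^esub> u \<preceq>\<^bsub>R\<^esub> \<zero>\<^bsub>R\<^esub>"
        by (auto simp: G_def)
      then have "f \<curlywedge>\<^bsub>R\<^esub> u = \<zero>\<^bsub>R\<^esub>"
        using FR u by (auto simp: le_zero_iff)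
      then have "f \<preceq>\<^bsub>R\<^esub> cp u"
        using f FR u le_cp' by auto
      then show ?thesis
        using Fu f cp u by blast
    qed
    have Fc: "\<not> (u \<in> F \<and> cp u \<in> F)" if "u \<in> carrier R" for u
      using Fm[of u "cp u"] cp that zF by auto
    have meetF: "u \<curlywedge>\<^bsub>R\<^esub> v \<in> F \<longleftrightarrow> u \<in> F \<and> v \<in> F" if "u \<in> carrier R" "v \<in> carrier R" for u v
      using Fm[of u v] Fu[of "u \<curlywedge>\<^bsub>R\<^esub> v" u] Fu[of "u \<curlywedge>\<^bsub>R\<^esub> v" v] meet_le1[OF that] meet_le2[OF that]
        that by blast
    have joinF: "u \<curlyvee>\<^bsub>R\<^esub> v \<in> F \<longleftrightarrow> u \<in> F \<or> v \<in> F" if uv: "u \<in> carrier R" "v \<in> carrier R" for u v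
    proof
      assume j: "u \<curlyvee>\<^bsub>R\<^esub> v \<in> F"
      show "u \<in> F \<or> v \<in> F"
      proof (rule ccontr)
        assume "\<not> ?thesis"
        then have n: "cp u \<in> F" "\<not> v \<in> F"
          using prime uv by auto
        have "cp u \<curlywedge>\<^bsub>R\<^esub> (u \<curlyvee>\<^bsub>R\<^esub> v) \<preceq>\<^bsub>R\<^esub> v"
          using uv cp by (simp add: dist meet_comm[of "cp u"] bound_simps meet_le1)
        then show False
          using n Fm[OF n(1) j] Fu uv by blast
      qed
    next
      assume "u \<in> F \<or> v \<in> F"
      then show "u \<curlyvee>\<^bsub>R\<^esub> v \<in> F"
        using Fu[of u "u \<curlyvee>\<^bsub>R\<^esub> v"] Fu[of v "u \<curlyvee>\<^bsub>R\<^esub> v"] uv join_ge1[OF uv] join_ge2[OF uv] by auto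
    qed
    have impF: "u \<rightharpoonup>\<^bsub>R\<^esub> v \<in> F \<longleftrightarrow> (u \<in> F \<longrightarrow> v \<in> F)" if uv: "u \<in> carrier R" "v \<in> carrier R" for u v
    proof
      assume i: "u \<rightharpoonup>\<^bsub>R\<^esub> v \<in> F"
      have "(u \<rightharpoonup>\<^bsub>R\<^esub> v) \<curlywedge>\<^bsub>R\<^esub> u \<preceq>\<^bsub>R\<^esub> v"
        using imp_elim[OF uv] uv by (simp add: mm)
      then show "u \<in> F \<longrightarrow> v \<in> F"
        using Fm[OF i] Fu uv by blast
    next
      assume i: "u \<in> F \<longrightarrow> v \<in> F"
      \<comment> \<open>The residual lies above both \<open>v\<close> and \<open>cp u\<close>, and
        one of these belongs to \<open>F\<close>.\<close>
      have "v \<preceq>\<^bsub>R\<^esub> u \<rightharpoonup>\<^bsub>R\<^esub> v"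
        using uv by (simp add: residuation[symmetric] mult_le1)
      moreover have "cp u \<preceq>\<^bsub>R\<^esub> u \<rightharpoonup>\<^bsub>R\<^esub> v"
        using uv cp by (simp add: residuation[symmetric] mm meet_comm[of "cp u"] zero_le)
      ultimately show "u \<rightharpoonup>\<^bsub>R\<^esub> v \<in> F"
        using i prime[OF uv(1)] Fu[of v "u \<rightharpoonup>\<^bsub>R\<^esub> v"] Fu[of "cp u" "u \<rightharpoonup>\<^bsub>R\<^esub> v"] uv by auto
    qed
    have "\<one>\<^bsub>R\<^esub> \<in> F"
      using Fu aF a le_one one_in_carrier by blast
    then have "resl_hom R two (\<lambda>u. u \<in> F)"
      using zF by (simp add: resl_hom_def two_def mm meetF joinF impF)
    moreover have "x \<in> F" "y \<notin> F"
      using aF meetF x y cp Fc by auto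
    ultimately show ?thesis
      by blast
  qed
  have "\<not> x \<preceq>\<^bsub>R\<^esub> y \<or> \<not> y \<preceq>\<^bsub>R\<^esub> x"
    using xy le_antisym[of x y] by blast
  then show ?thesis
    using *[OF xy(1,2)] *[OF xy(2,1)] by metis
qed

section \<open>The algebras K3, K4 and K8\<close>

text \<open>The chain \<open>(False, True)\<close>, \<open>(True, True)\<close>,
  \<open>(True, False)\<close>: zero, the unit and the negation of zero.\<close>

definition K3 :: "(bool \<times> bool) resl"
  where "K3 = K4\<lparr>carrier := - {(False, False)}\<rparr>"

lemma resl_algebra_K4: "resl_algebra K4"
  by unfold_locales (auto simp: K4_def K_def two_def)

lemma resl_algebra_K3: "resl_algebra K3"
  by unfold_locales (auto simp: K3_def K4_def K_def two_def)

lemma resl_algebra_two_plus_two: "resl_algebra two_plus_two"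
  by unfold_locales (auto simp: two_plus_two_def)

lemma resl_algebra_K_two_plus_two: "resl_algebra (K two_plus_two)"
  by (rule resl_algebra_K[OF resl_algebra_two_plus_two])

lemma resl_algebra_K_two_plus_two_minus:
  "resl_algebra ((K two_plus_two)\<lparr>carrier := {0, 1, 2} \<times> {0, 1, 2} - {(0, 0)}\<rparr>)"
proof -
  define S :: "(nat \<times> nat) set" where "S = {0, 1, 2} \<times> {0, 1, 2} - {(0, 0)}"
  have "\<forall>x\<in>S. \<forall>y\<in>S. \<forall>f\<in>set [rjoin, rmeet, mult, rimp]. f (K two_plus_two) x y \<in> S"
    unfolding S_def by code_simp
  moreover have "\<zero>\<^bsub>K two_plus_two\<^esub> \<in> S" "\<one>\<^bsub>K two_plus_two\<^esub> \<in> S"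
    by (simp_all add: S_def K_def two_plus_two_def)
  ultimately show ?thesis
    unfolding S_def[symmetric] by unfold_locales simp_all
qed

text \<open>Removing \<open>(0, 0)\<close> leaves an admissible subalgebra, and every other element
  is generated by the negative cone, which consists of the pairs \<open>(a, 2)\<close>.\<close>

lemma carrier_K8: "carrier K8 = {0, 1, 2} \<times> {0, 1, 2} - {(0, 0)}" (is "_ = ?S")
proof
  have "admissible ?S (K two_plus_two)"
    unfolding admissible_def
  proof (intro conjI)
    show "resl_algebra ((K two_plus_two)\<lparr>carrier := ?S\<rparr>)"
      by (rule resl_algebra_K_two_plus_two_minus)
    have "{a \<in> ?S. a \<preceq>\<^bsub>K two_plus_two\<^esub> (2, 2)} =
        {a \<in> carrier (K two_plus_two). a \<preceq>\<^bsub>K two_plus_two\<^esub> (2, 2)}"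
      by (auto simp: rle_def K_def two_plus_two_def)
    then show "neg_cone ((K two_plus_two)\<lparr>carrier := ?S\<rparr>) = neg_cone (K two_plus_two)"
      by (simp add: neg_cone_def rle_def K_def two_plus_two_def)
  qed (auto simp: K_def two_plus_two_def)
  then show "carrier K8 \<subseteq> ?S"
    by (auto simp: K8_def K0_def)
  have "?S \<subseteq> S" if S: "admissible S (K two_plus_two)" for S
  proof -
    have "carrier (neg_cone ((K two_plus_two)\<lparr>carrier := S\<rparr>)) = carrier (neg_cone (K two_plus_two))"
      using S by (simp add: admissible_def)
    then have "{a \<in> S. a \<preceq>\<^bsub>K two_plus_two\<^esub> (2, 2)} =
        {a \<in> carrier (K two_plus_two). a \<preceq>\<^bsub>K two_plus_two\<^esub> (2, 2)}"
      by (simp add: rle_def K_def two_plus_two_def)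
    moreover have "{(0, 2), (1, 2), (2, 2)} \<subseteq>
        {a \<in> carrier (K two_plus_two). a \<preceq>\<^bsub>K two_plus_two\<^esub> (2, 2)}"
      by (simp add: rle_def K_def two_plus_two_def)
    ultimately have neg: "(0, 2) \<in> S" "(1, 2) \<in> S" "(2, 2) \<in> S"
      by blast+
    interpret S: resl_algebra "(K two_plus_two)\<lparr>carrier := S\<rparr>"
      using S by (simp add: admissible_def)
    have imp: "x \<rightharpoonup>\<^bsub>K two_plus_two\<^esub> y \<in> S" and meet: "x \<curlywedge>\<^bsub>K two_plus_two\<^esub> y \<in> S"
      if "x \<in> S" "y \<in> S" for x y
      using S.imp_closed S.meet_closed that by auto
    \<comment> \<open>Negation swaps coordinates and gives \<open>(2, 0)\<close> and
      \<open>(2, 1)\<close>; the residual of \<open>(1, 2)\<close> into \<open>(0, 2)\<close> is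
      \<open>(0, 1)\<close>. The negation \<open>(1, 0)\<close> of the latter, met with
      \<open>(2, 1)\<close>, gives \<open>(1, 1)\<close>.\<close>
    have pos: "(2, 0) \<in> S" "(2, 1) \<in> S" "(0, 1) \<in> S"
      using imp[OF neg(1,3)] imp[OF neg(2,3)] imp[OF neg(2,1)]
      by (simp_all add: K_def two_plus_two_def)
    have "(1, 0) \<in> S"
      using imp[OF pos(3) neg(3)] by (simp add: K_def two_plus_two_def)
    moreover from this have "(1, 1) \<in> S"
      using meet[OF _ pos(2)] by (fastforce simp: K_def two_plus_two_def)
    ultimately show ?thesis
      using neg pos by auto
  qed
  then show "?S \<subseteq> carrier K8"
    by (auto simp: K8_def K0_def)
qed

lemma K8_eq: "K8 = (K two_plus_two)\<lparr>carrier := {0, 1, 2} \<times> {0, 1, 2} - {(0, 0)}\<rparr>"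
  using carrier_K8 by (simp add: K8_def K0_def)

lemma resl_algebra_K8: "resl_algebra K8"
  unfolding K8_eq by (rule resl_algebra_K_two_plus_two_minus)

lemma Th_K4_le_Th_K3: "Th {K4} \<subseteq> Th {K3}"
  unfolding K3_def using resl_algebra_K3
  by (intro Th_mono_subalgebra resl_algebra_K4) (auto simp: K3_def K4_def K_def two_def)

text \<open>With the next lemma, this lets the axioms of \<open>K(SRL)\<close> be checked once, on
  the nine-element \<open>K two_plus_two\<close>, for both \<open>K4\<close> and
  \<open>K8\<close>.\<close>

lemma Th_K_two_plus_two_le_Th_K8: "Th {K two_plus_two} \<subseteq> Th {K8}"
  unfolding K8_eq using resl_algebra_K8
  by (intro Th_mono_subalgebra resl_algebra_K_two_plus_two)
    (auto simp: K8_eq K_def two_plus_two_def)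

lemma Th_K_two_plus_two_le_Th_K4: "Th {K two_plus_two} \<subseteq> Th {K4}"
proof (rule Th_mono_hom[OF resl_algebra_K_two_plus_two resl_algebra_K4 resl_hom_id])
  let ?h = "\<lambda>b. if b then 2 else 0 :: nat"
  show "resl_hom K4 (K two_plus_two) (map_prod ?h ?h)"
    unfolding K4_def
    by (rule K_hom, unfold_locales) (auto simp: two_def two_plus_two_def resl_hom_def)
  show "inj_on (map_prod ?h ?h) (carrier K4)"
    by (rule inj_onI) (auto split: if_splits)
  show "map_prod ?h ?h ` carrier K4 \<subseteq> id ` carrier (K two_plus_two)"
  proof -
    have "?h b \<in> carrier two_plus_two" for b
      by (simp add: two_plus_two_def)
    then show ?thesis
      by (auto simp: K_def)
  qed
qed

section \<open>Equations in three variables\<close>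

definition assign3 :: "'a \<Rightarrow> 'a \<Rightarrow> 'a \<Rightarrow> nat \<Rightarrow> 'a"
  where "assign3 x y z n = (if n = 0 then x else if n = 1 then y else z)"

lemma assign3_simps: "assign3 x y z 0 = x" "assign3 x y z 1 = y" "assign3 x y z 2 = z"
  by (simp_all add: assign3_def)

lemma range_assign3: "range (assign3 x y z) \<subseteq> S \<longleftrightarrow> x \<in> S \<and> y \<in> S \<and> z \<in> S"
proof
  assume "range (assign3 x y z) \<subseteq> S"
  then have "assign3 x y z 0 \<in> S" "assign3 x y z 1 \<in> S" "assign3 x y z 2 \<in> S"
    by blast+
  then show "x \<in> S \<and> y \<in> S \<and> z \<in> S"
    by (simp add: assign3_def)
qed (auto simp: assign3_def)

text \<open>Replaces infinite assignments by triples, so that equations can be decided by evaluation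
  on a finite algebra.\<close>

lemma satisfies_three:
  assumes "vars (fst e) \<union> vars (snd e) \<subseteq> {0, 1, 2}"
  shows "satisfies A e \<longleftrightarrow> (\<forall>x\<in>carrier A. \<forall>y\<in>carrier A. \<forall>z\<in>carrier A.
    eval A (assign3 x y z) (fst e) = eval A (assign3 x y z) (snd e))" (is "_ \<longleftrightarrow> ?r")
proof
  assume "satisfies A e"
  then show ?r
    by (simp add: satisfies_def range_assign3)
next
  assume r: ?r
  show "satisfies A e"
    unfolding satisfies_def
  proof (intro allI impI)
    fix \<rho> :: "nat \<Rightarrow> _" assume \<rho>: "range \<rho> \<subseteq> carrier A"
    have "eval A \<rho> t = eval A (assign3 (\<rho> 0) (\<rho> 1) (\<rho> 2)) t" if "vars t \<subseteq> {0, 1, 2}" for t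
      by (rule eval_cong) (use that in \<open>auto simp: assign3_def\<close>)
    then show "eval A \<rho> (fst e) = eval A \<rho> (snd e)"
      using r \<rho> assms by (simp add: range_subsetD)
  qed
qed

abbreviation (input) vx where "vx \<equiv> Var 0"
abbreviation (input) vy where "vy \<equiv> Var 1"
abbreviation (input) vz where "vz \<equiv> Var 2"
abbreviation (input) Neg1 where "Neg1 t \<equiv> Meet (Imp t Zero) One"

definition lattice_eqs :: "(rterm \<times> rterm) list"
  where "lattice_eqs = [
    (Mult (Mult vx vy) vz, Mult vx (Mult vy vz)), (Mult vx vy, Mult vy vx), (Mult One vx, vx),
    (Join vx vy, Join vy vx), (Meet vx vy, Meet vy vx),
    (Join (Join vx vy) vz, Join vx (Join vy vz)), (Meet (Meet vx vy) vz, Meet vx (Meet vy vz)),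
    (Join vx (Meet vx vy), vx), (Meet vx (Join vx vy), vx)]"

text \<open>The first three equations after \<open>lattice_eqs\<close> axiomatize residuation.\<close>

definition K_SRL_eqs :: "(rterm \<times> rterm) list"
  where "K_SRL_eqs = lattice_eqs @ [
    (Meet vx (Imp vy (Join (Mult vx vy) vz)), vx), (Join (Mult (Imp vy vz) vy) vz, vz),
    (Mult (Join vx vy) vz, Join (Mult vx vz) (Mult vy vz)),
    (Meet Zero vx, Zero), (Imp (Imp vx One) One, vx),
    (Meet One (Join vy vz), Join (Meet One vy) (Meet One vz)),
    (Meet vx (Join One vz), Join (Meet vx One) (Meet vx vz)),
    (Join One (Meet vy vz), Meet (Join One vy) (Join One vz)),
    (Join vx (Meet One vz), Meet (Join vx One) (Join vx vz)),
    (Meet (Mult vx vy) One, Mult (Meet vx One) (Meet vy One)),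
    (Meet (Imp (Meet vx One) vy) (Imp (Meet (Imp vy One) One) (Imp vx One)), Imp vx vy),
    (Join (Neg1 (Meet vx One)) (Neg1 (Neg1 (Meet vx One))), One)]"

text \<open>\<open>Meet vx One\<close> ranges over the negative cone and \<open>Neg1\<close> is the
  negation of the cone, so this is the excluded middle there.\<close>

definition boolean_eq :: "rterm \<times> rterm"
  where "boolean_eq = (Join (Meet vx One) (Neg1 (Meet vx One)), One)"

text \<open>In \<open>K(A)\<close>, this equation says that no element \<open>(a, b)\<close> has \<open>\<not>a \<and> \<not>b \<noteq> 0\<close>; it excludes \<open>(0, 0)\<close>.\<close>

definition no_double_zero_eq :: "rterm \<times> rterm"
  where "no_double_zero_eq =
    (Meet (Neg1 (Meet vx One)) (Neg1 (Meet (Imp vx One) One)), Zero)"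

lemma K_SRL_eqs_vars: "e \<in> set K_SRL_eqs \<Longrightarrow> vars (fst e) \<union> vars (snd e) \<subseteq> {0, 1, 2}"
  by (auto simp: K_SRL_eqs_def lattice_eqs_def)

lemma K_SRL_eqs_K_two_plus_two: "set K_SRL_eqs \<subseteq> Th {K two_plus_two}"
proof -
  define L where "L = List.product [0, 1, 2::nat] [0, 1, 2::nat]"
  have L: "carrier (K two_plus_two) = set L"
    by (simp add: L_def K_def two_plus_two_def)
  have "\<forall>e\<in>set K_SRL_eqs. \<forall>x\<in>set L. \<forall>y\<in>set L. \<forall>z\<in>set L.
      eval (K two_plus_two) (assign3 x y z) (fst e) = eval (K two_plus_two) (assign3 x y z) (snd e)"
    unfolding L_def by code_simp
  then show ?thesis
    by (auto simp: Th_def satisfies_three[OF K_SRL_eqs_vars] L)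
qed

text \<open>Recovers the order-theoretic axioms from equations; thus every algebra satisfying the
  identities of \<open>K two_plus_two\<close> lies in \<open>K(SRL)\<close>.\<close>

lemma Mod_K_SRL_eqs:
  assumes "A \<in> Mod (set K_SRL_eqs)"
  shows "A \<in> K_class SRL"
proof -
  interpret resl_algebra A
    using assms by (simp add: Mod_def)
  have eqs: "\<forall>e\<in>set K_SRL_eqs. eval A (assign3 x y z) (fst e) = eval A (assign3 x y z) (snd e)"
    if "x \<in> carrier A" "y \<in> carrier A" "z \<in> carrier A" for x y z
  proof
    fix e assume e: "e \<in> set K_SRL_eqs"
    then have "satisfies A e"
      using assms by (simp add: Mod_def)
    then show "eval A (assign3 x y z) (fst e) = eval A (assign3 x y z) (snd e)"
      using satisfies_three[OF K_SRL_eqs_vars[OF e], THEN iffD1, rule_format, OF _ that] by simp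
  qed
  note all = eqs[unfolded K_SRL_eqs_def lattice_eqs_def append.simps list.set ball_simps eval.simps
      fst_conv snd_conv assign3_simps]
  have lattice:
    "(x \<otimes>\<^bsub>A\<^esub> y) \<otimes>\<^bsub>A\<^esub> z = x \<otimes>\<^bsub>A\<^esub> (y \<otimes>\<^bsub>A\<^esub> z)" "x \<otimes>\<^bsub>A\<^esub> y = y \<otimes>\<^bsub>A\<^esub> x" "\<one>\<^bsub>A\<^esub> \<otimes>\<^bsub>A\<^esub> x = x"
    "x \<curlyvee>\<^bsub>A\<^esub> y = y \<curlyvee>\<^bsub>A\<^esub> x" "x \<curlywedge>\<^bsub>A\<^esub> y = y \<curlywedge>\<^bsub>A\<^esub> x"
    "(x \<curlyvee>\<^bsub>A\<^esub> y) \<curlyvee>\<^bsub>A\<^esub> z = x \<curlyvee>\<^bsub>A\<^esub> (y \<curlyvee>\<^bsub>A\<^esub> z)" "(x \<curlywedge>\<^bsub>A\<^esub> y) \<curlywedge>\<^bsub>A\<^esub> z = x \<curlywedge>\<^bsub>A\<^esub> (y \<curlywedge>\<^bsub>A\<^esub> z)"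
    "x \<curlyvee>\<^bsub>A\<^esub> (x \<curlywedge>\<^bsub>A\<^esub> y) = x" "x \<curlywedge>\<^bsub>A\<^esub> (x \<curlyvee>\<^bsub>A\<^esub> y) = x"
    if "x \<in> carrier A" "y \<in> carrier A" "z \<in> carrier A" for x y z
    using all[OF that] by blast+
  have res: "x \<curlywedge>\<^bsub>A\<^esub> (y \<rightharpoonup>\<^bsub>A\<^esub> (x \<otimes>\<^bsub>A\<^esub> y) \<curlyvee>\<^bsub>A\<^esub> z) = x"
    "((y \<rightharpoonup>\<^bsub>A\<^esub> z) \<otimes>\<^bsub>A\<^esub> y) \<curlyvee>\<^bsub>A\<^esub> z = z"
    "(x \<curlyvee>\<^bsub>A\<^esub> y) \<otimes>\<^bsub>A\<^esub> z = (x \<otimes>\<^bsub>A\<^esub> z) \<curlyvee>\<^bsub>A\<^esub> (y \<otimes>\<^bsub>A\<^esub> z)"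
    if "x \<in> carrier A" "y \<in> carrier A" "z \<in> carrier A" for x y z
    using all[OF that] by blast+
  have comm_res: "comm_res_lattice A"
  proof unfold_locales
    fix x y z assume xyz: "x \<in> carrier A" "y \<in> carrier A" "z \<in> carrier A"
    show "(x \<otimes>\<^bsub>A\<^esub> y) \<preceq>\<^bsub>A\<^esub> z \<longleftrightarrow> x \<preceq>\<^bsub>A\<^esub> (y \<rightharpoonup>\<^bsub>A\<^esub> z)"
    proof
      assume "(x \<otimes>\<^bsub>A\<^esub> y) \<preceq>\<^bsub>A\<^esub> z"
      then have "(x \<otimes>\<^bsub>A\<^esub> y) \<curlyvee>\<^bsub>A\<^esub> z = z"
        unfolding rle_def by (metis lattice(4,5,8) mult_closed meet_closed xyz)
      \<comment> \<open>The first residuation equation, with its inner join collapsed to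
        \<open>z\<close>.\<close>
      then show "x \<preceq>\<^bsub>A\<^esub> (y \<rightharpoonup>\<^bsub>A\<^esub> z)"
        unfolding rle_def using res(1)[OF xyz] by simp
    next
      let ?w = "y \<rightharpoonup>\<^bsub>A\<^esub> z"
      have c: "?w \<in> carrier A" "x \<otimes>\<^bsub>A\<^esub> y \<in> carrier A" "?w \<otimes>\<^bsub>A\<^esub> y \<in> carrier A"
        using xyz by (simp_all add: imp_closed mult_closed)
      assume "x \<preceq>\<^bsub>A\<^esub> ?w"
      then have "x \<curlyvee>\<^bsub>A\<^esub> ?w = ?w"
        unfolding rle_def by (metis lattice(4,5,8) c meet_closed xyz)
      \<comment> \<open>Distributivity over joins makes multiplication by \<open>y\<close> monotone,
        and \<open>?w \<otimes> y\<close> is below \<open>z\<close> by the second residuation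
        equation.\<close>
      then have "?w \<otimes>\<^bsub>A\<^esub> y = (x \<otimes>\<^bsub>A\<^esub> y) \<curlyvee>\<^bsub>A\<^esub> (?w \<otimes>\<^bsub>A\<^esub> y)"
        using res(3)[OF xyz(1) c(1) xyz(2)] by simp
      then have "(x \<otimes>\<^bsub>A\<^esub> y) \<curlyvee>\<^bsub>A\<^esub> z = z"
        using lattice(6)[OF c(2,3) xyz(3)] res(2)[OF xyz] by simp
      then show "(x \<otimes>\<^bsub>A\<^esub> y) \<preceq>\<^bsub>A\<^esub> z"
        unfolding rle_def using lattice(9)[OF c(2) xyz(3) xyz(3)] by simp
    qed
  next
    fix x assume "x \<in> carrier A"
    then show "\<one>\<^bsub>A\<^esub> \<otimes>\<^bsub>A\<^esub> x = x" "x \<otimes>\<^bsub>A\<^esub> \<one>\<^bsub>A\<^esub> = x"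
      using lattice(2)[of x "\<one>\<^bsub>A\<^esub>" x] lattice(3)[of x x x] one_in_carrier by simp_all
  qed (rule lattice mult_closed one_in_carrier; assumption)+
  have K: "\<zero>\<^bsub>A\<^esub> \<curlywedge>\<^bsub>A\<^esub> x = \<zero>\<^bsub>A\<^esub>" "(x \<rightharpoonup>\<^bsub>A\<^esub> \<one>\<^bsub>A\<^esub>) \<rightharpoonup>\<^bsub>A\<^esub> \<one>\<^bsub>A\<^esub> = x"
    "\<one>\<^bsub>A\<^esub> \<curlywedge>\<^bsub>A\<^esub> (y \<curlyvee>\<^bsub>A\<^esub> z) = (\<one>\<^bsub>A\<^esub> \<curlywedge>\<^bsub>A\<^esub> y) \<curlyvee>\<^bsub>A\<^esub> (\<one>\<^bsub>A\<^esub> \<curlywedge>\<^bsub>A\<^esub> z)"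
    "x \<curlywedge>\<^bsub>A\<^esub> (\<one>\<^bsub>A\<^esub> \<curlyvee>\<^bsub>A\<^esub> z) = (x \<curlywedge>\<^bsub>A\<^esub> \<one>\<^bsub>A\<^esub>) \<curlyvee>\<^bsub>A\<^esub> (x \<curlywedge>\<^bsub>A\<^esub> z)"
    "\<one>\<^bsub>A\<^esub> \<curlyvee>\<^bsub>A\<^esub> (y \<curlywedge>\<^bsub>A\<^esub> z) = (\<one>\<^bsub>A\<^esub> \<curlyvee>\<^bsub>A\<^esub> y) \<curlywedge>\<^bsub>A\<^esub> (\<one>\<^bsub>A\<^esub> \<curlyvee>\<^bsub>A\<^esub> z)"
    "x \<curlyvee>\<^bsub>A\<^esub> (\<one>\<^bsub>A\<^esub> \<curlywedge>\<^bsub>A\<^esub> z) = (x \<curlyvee>\<^bsub>A\<^esub> \<one>\<^bsub>A\<^esub>) \<curlywedge>\<^bsub>A\<^esub> (x \<curlyvee>\<^bsub>A\<^esub> z)"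
    "(x \<otimes>\<^bsub>A\<^esub> y) \<curlywedge>\<^bsub>A\<^esub> \<one>\<^bsub>A\<^esub> = (x \<curlywedge>\<^bsub>A\<^esub> \<one>\<^bsub>A\<^esub>) \<otimes>\<^bsub>A\<^esub> (y \<curlywedge>\<^bsub>A\<^esub> \<one>\<^bsub>A\<^esub>)"
    "((x \<curlywedge>\<^bsub>A\<^esub> \<one>\<^bsub>A\<^esub>) \<rightharpoonup>\<^bsub>A\<^esub> y) \<curlywedge>\<^bsub>A\<^esub> (((y \<rightharpoonup>\<^bsub>A\<^esub> \<one>\<^bsub>A\<^esub>) \<curlywedge>\<^bsub>A\<^esub> \<one>\<^bsub>A\<^esub>) \<rightharpoonup>\<^bsub>A\<^esub> (x \<rightharpoonup>\<^bsub>A\<^esub> \<one>\<^bsub>A\<^esub>)) = x \<rightharpoonup>\<^bsub>A\<^esub> y"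
    "(((x \<curlywedge>\<^bsub>A\<^esub> \<one>\<^bsub>A\<^esub>) \<rightharpoonup>\<^bsub>A\<^esub> \<zero>\<^bsub>A\<^esub>) \<curlywedge>\<^bsub>A\<^esub> \<one>\<^bsub>A\<^esub>) \<curlyvee>\<^bsub>A\<^esub>
      (((((x \<curlywedge>\<^bsub>A\<^esub> \<one>\<^bsub>A\<^esub>) \<rightharpoonup>\<^bsub>A\<^esub> \<zero>\<^bsub>A\<^esub>) \<curlywedge>\<^bsub>A\<^esub> \<one>\<^bsub>A\<^esub>) \<rightharpoonup>\<^bsub>A\<^esub> \<zero>\<^bsub>A\<^esub>) \<curlywedge>\<^bsub>A\<^esub> \<one>\<^bsub>A\<^esub>) = \<one>\<^bsub>A\<^esub>"
    if "x \<in> carrier A" "y \<in> carrier A" "z \<in> carrier A" for x y z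
    using all[OF that] by blast+
  interpret comm_res_lattice A
    by (rule comm_res)
  have BK: "bounded_K_lattice A"
  proof unfold_locales
    fix x y z
    assume xyz: "x \<in> carrier A" "y \<in> carrier A" "z \<in> carrier A" and "\<one>\<^bsub>A\<^esub> \<in> {x, y, z}"
    then have one: "x = \<one>\<^bsub>A\<^esub> \<or> y = \<one>\<^bsub>A\<^esub> \<or> z = \<one>\<^bsub>A\<^esub>"
      by auto
    \<comment> \<open>The equations put the unit in the first or second place; the third place
      follows by commutativity.\<close>
    from one show "x \<curlywedge>\<^bsub>A\<^esub> (y \<curlyvee>\<^bsub>A\<^esub> z) = (x \<curlywedge>\<^bsub>A\<^esub> y) \<curlyvee>\<^bsub>A\<^esub> (x \<curlywedge>\<^bsub>A\<^esub> z)"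
      using K(3,4)[OF xyz] K(4)[of x y y] xyz
      by (elim disjE) (simp_all add: join_comm)
    show "x \<curlyvee>\<^bsub>A\<^esub> (y \<curlywedge>\<^bsub>A\<^esub> z) = (x \<curlyvee>\<^bsub>A\<^esub> y) \<curlywedge>\<^bsub>A\<^esub> (x \<curlyvee>\<^bsub>A\<^esub> z)"
      using one K(5,6)[OF xyz] K(6)[of x y y] xyz
      by (elim disjE) (simp_all add: meet_comm)
  qed (use K in \<open>auto simp: rle_def\<close>)
  interpret bounded_K_lattice A
    by (rule BK)
  have "neg_cone A \<in> SRL"
    using bcrl_neg_cone by (auto simp: SRL_def rle_def dest: K(9)[OF _ one_in_carrier one_in_carrier])
  then show ?thesis
    using BK by (simp add: K_class_def)
qed

lemma boolean_eq_iff: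
  "boolean_eq \<in> Th {A} \<longleftrightarrow> (\<forall>x\<in>carrier A. eval A (\<lambda>n. x) (fst boolean_eq) = \<one>\<^bsub>A\<^esub>)"
proof -
  have "satisfies A boolean_eq \<longleftrightarrow> (\<forall>x\<in>carrier A. \<forall>y\<in>carrier A. \<forall>z\<in>carrier A.
      eval A (assign3 x y z) (fst boolean_eq) = eval A (assign3 x y z) (snd boolean_eq))"
    by (rule satisfies_three) (simp add: boolean_eq_def)
  then show ?thesis
    by (auto simp: Th_def boolean_eq_def assign3_simps)
qed

lemma no_double_zero_eq_iff:
  "no_double_zero_eq \<in> Th {A} \<longleftrightarrow>
    (\<forall>x\<in>carrier A. eval A (\<lambda>n. x) (fst no_double_zero_eq) = \<zero>\<^bsub>A\<^esub>)"
proof -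
  have "satisfies A no_double_zero_eq \<longleftrightarrow> (\<forall>x\<in>carrier A. \<forall>y\<in>carrier A. \<forall>z\<in>carrier A.
      eval A (assign3 x y z) (fst no_double_zero_eq) = eval A (assign3 x y z) (snd no_double_zero_eq))"
    by (rule satisfies_three) (simp add: no_double_zero_eq_def)
  then show ?thesis
    by (auto simp: Th_def no_double_zero_eq_def assign3_simps)
qed

text \<open>\<open>(False, False)\<close> refutes \<open>no_double_zero_eq\<close> in
  \<open>K4\<close>, and \<open>(1, 2)\<close>, the middle element of the cone, refutes
  \<open>boolean_eq\<close> in \<open>K8\<close>. This makes the two algebras incomparable.\<close>

lemma separating_eqs:
  "boolean_eq \<in> Th {K4}" "no_double_zero_eq \<notin> Th {K4}"
  "boolean_eq \<notin> Th {K8}" "no_double_zero_eq \<in> Th {K8}"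
  "no_double_zero_eq \<in> Th {K3}"
proof -
  show "boolean_eq \<in> Th {K4}" "no_double_zero_eq \<in> Th {K3}" "no_double_zero_eq \<notin> Th {K4}"
    unfolding boolean_eq_iff no_double_zero_eq_iff
    by (auto simp: boolean_eq_def no_double_zero_eq_def K3_def K4_def K_def two_def)
  have "eval (K two_plus_two) (\<lambda>n. (1, 2)) (fst boolean_eq) \<noteq> \<one>\<^bsub>K two_plus_two\<^esub>"
    by code_simp
  then show "boolean_eq \<notin> Th {K8}"
    unfolding boolean_eq_iff K8_eq by (auto intro!: bexI[of _ "(1, 2)"])
  have "\<forall>x\<in>{0, 1, 2} \<times> {0, 1, 2} - {(0, 0)}.
      eval (K two_plus_two) (\<lambda>n. x) (fst no_double_zero_eq) = \<zero>\<^bsub>K two_plus_two\<^esub>"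
    by code_simp
  then show "no_double_zero_eq \<in> Th {K8}"
    unfolding no_double_zero_eq_iff K8_eq eval_carrier_update by simp
qed

section \<open>Small algebras in the variety of a given algebra\<close>

text \<open>Twists of distinct elements differ in some coordinate. A homomorphism from the cone to
  \<open>two\<close> that separates these coordinates, applied to both by \<open>K_hom\<close>,
  separates the elements.\<close>

lemma K_class_BA_separation:
  assumes A: "A \<in> K_class BA" and xy: "x \<in> carrier A" "y \<in> carrier A" "x \<noteq> y"
  shows "\<exists>g. resl_hom A K4 g \<and> g x \<noteq> g y"
proof -
  interpret bounded_K_lattice A
    using A by (simp add: K_class_def)
  interpret R: bcrl "neg_cone A"
    by (rule bcrl_neg_cone)
  have BA: "neg_cone A \<in> BA"
    using A by (simp add: K_class_def)
  have "twist A x \<noteq> twist A y"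
    using twist_inj xy by (auto dest: inj_onD)
  moreover have "twist A z \<in> carrier (neg_cone A) \<times> carrier (neg_cone A)" if "z \<in> carrier A" for z
    using twist_hom that by (auto simp: resl_hom_def K_def image_subset_iff)
  ultimately obtain u v where "u \<in> carrier (neg_cone A)" "v \<in> carrier (neg_cone A)" "u \<noteq> v"
    and uv: "(u = fst (twist A x) \<and> v = fst (twist A y)) \<or> (u = snd (twist A x) \<and> v = snd (twist A y))"
    using xy(1,2) by (metis mem_Times_iff prod_eqI)
  then obtain h where h': "resl_hom (neg_cone A) two h" "h u \<noteq> h v"
    using BA_separation[OF BA] by metis
  have h: "map_prod h h (twist A x) \<noteq> map_prod h h (twist A y)"
    using uv h'(2) by (metis fst_map_prod snd_map_prod)
  have "resl_hom A K4 (map_prod h h \<circ> twist A)"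
    unfolding K4_def by (intro resl_hom_comp[OF twist_hom] K_hom h'(1)) unfold_locales
  then show ?thesis
    using h by (metis comp_apply)
qed

lemma Th_K4_le:
  assumes "A \<in> K_class BA"
  shows "Th {K4} \<subseteq> Th {A}"
proof (rule Th_mono_subdirect)
  show "resl_algebra A"
    using assms by (simp add: K_class_def bounded_K_lattice_def comm_res_lattice_def)
qed (rule K_class_BA_separation[OF assms])

text \<open>A homomorphism to \<open>K4\<close> that hits \<open>(False, False)\<close> is onto,
  since the constants supply the other three elements. If there is none, all separating
  homomorphisms land in \<open>K3\<close>.\<close>

lemma Th_le_K4_or_K3_le_Th:
  assumes A: "A \<in> K_class BA"
  shows "Th {A} \<subseteq> Th {K4} \<or> Th {K3} \<subseteq> Th {A}"
proof (cases "\<exists>g. resl_hom A K4 g \<and> (False, False) \<in> g ` carrier A")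
  case True
  then obtain g where g: "resl_hom A K4 g" "(False, False) \<in> g ` carrier A"
    by blast
  interpret bounded_K_lattice A
    using A by (simp add: K_class_def)
  have "g \<zero>\<^bsub>A\<^esub> = (False, True)" "g \<one>\<^bsub>A\<^esub> = (True, True)" "g (\<zero>\<^bsub>A\<^esub> \<rightharpoonup>\<^bsub>A\<^esub> \<one>\<^bsub>A\<^esub>) = (True, False)"
    using g(1) by (simp_all add: resl_hom_def K4_def K_def two_def)
  then have *: "(False, True) \<in> g ` carrier A" "(True, True) \<in> g ` carrier A"
      "(True, False) \<in> g ` carrier A"
    by (metis closed(4,5,6) imageI)+
  have "g ` carrier A = UNIV"
    using * g(2) by (auto simp: set_eq_iff) (metis (full_types) image_eqI)+
  then have "Th {A} \<subseteq> Th {K4}"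
    by (intro Th_mono_hom[OF _ resl_algebra_K4 g(1) resl_hom_id]) (unfold_locales, auto)
  then show ?thesis ..
next
  case False
  have "Th {K3} \<subseteq> Th {A}"
  proof (rule Th_mono_subdirect)
    show "resl_algebra A"
      using A by (simp add: K_class_def bounded_K_lattice_def comm_res_lattice_def)
    fix x y assume "x \<in> carrier A" "y \<in> carrier A" "x \<noteq> y"
    then obtain g where g: "resl_hom A K4 g" "g x \<noteq> g y"
      using K_class_BA_separation[OF A] by blast
    then have "resl_hom A K3 g"
      using False by (auto simp: resl_hom_def K3_def)
    then show "\<exists>g. resl_hom A K3 g \<and> g x \<noteq> g y"
      using g(2) by blast
  qed
  then show ?thesis ..
qed

context bounded_K_lattice
begin

lemma Th_le_Th_K3:
  assumes nontrivial: "x \<in> carrier A" "y \<in> carrier A" "x \<noteq> y"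
  shows "Th {A} \<subseteq> Th {K3}"
proof -
  interpret R: bcrl "neg_cone A"
    by (rule bcrl_neg_cone)
  let ?h = "\<lambda>b. if b then \<one> else \<zero>"
  \<comment> \<open>Zero is absorbing, so \<open>\<zero> = \<one>\<close> would make
    \<open>A\<close> trivial.\<close>
  have ne: "\<zero> \<noteq> \<one>"
  proof
    assume "\<zero> = \<one>"
    then have "z = \<zero>" if "z \<in> carrier A" for z
      using zero_mult[OF zero_le that] that by simp
    then show False
      using nontrivial by metis
  qed
  have "resl_hom two (neg_cone A) ?h"
    using R.two_hom unfolding neg_cone_simps .
  then have "resl_hom K4 (K (neg_cone A)) (map_prod ?h ?h)"
    unfolding K4_def by (intro K_hom) (unfold_locales, auto simp: two_def)
  then have hom: "resl_hom K3 (K (neg_cone A)) (map_prod ?h ?h)"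
    unfolding K3_def by (rule resl_hom_subalgebra) (simp add: K4_def K_def two_def)
  show ?thesis
  proof (rule Th_mono_hom[OF _ resl_algebra_K3 twist_hom hom])
    show "inj_on (map_prod ?h ?h) (carrier K3)"
      using ne by (auto simp: inj_on_def split: if_splits)
    have "twist A \<zero> = (\<zero>, \<one>)" "twist A \<one> = (\<one>, \<one>)"
      using twist_hom by (simp_all add: resl_hom_def K_def)
    moreover from this have "twist A (\<zero> \<rightharpoonup> \<one>) = (\<one>, \<zero>)"
      by (simp add: twist_neg)
    ultimately have "(\<zero>, \<one>) \<in> twist A ` carrier A" "(\<one>, \<one>) \<in> twist A ` carrier A"
        "(\<one>, \<zero>) \<in> twist A ` carrier A"
      by (metis closed(4,5,6) imageI)+
    then show "map_prod ?h ?h ` carrier K3 \<subseteq> twist A ` carrier A"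
      by (auto simp: K3_def split: if_splits)
  qed unfold_locales
qed

text \<open>\<open>\<zero>\<close>, \<open>c\<close>, \<open>\<one>\<close> form a three-element
  chain in the cone, which puts \<open>K8\<close> into \<open>K (neg_cone A)\<close>. The twist map
  need not be onto, so a preimage is exhibited for each of the eight pairs.\<close>

lemma Th_le_Th_K8:
  assumes c: "c \<in> carrier (neg_cone A)" "c \<noteq> \<one>" "c \<otimes> c = c" "c \<rightharpoonup>\<^bsub>neg_cone A\<^esub> \<zero> = \<zero>"
  shows "Th {A} \<subseteq> Th {K8}"
proof -
  interpret R: bcrl "neg_cone A"
    by (rule bcrl_neg_cone)
  let ?R = "neg_cone A"
  let ?h = "\<lambda>n::nat. if n = 0 then \<zero> else if n = 1 then c else \<one>"
  have cA: "c \<in> carrier A"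
    using c(1) by simp
  have z: "\<zero> \<rightharpoonup>\<^bsub>?R\<^esub> \<zero> = \<one>"
    using R.imp_eq_one[of \<zero> \<zero>] R.zero_in_carrier R.le_refl[of \<zero>] by simp
  have c0: "c \<noteq> \<zero>"
    using c(2,4) z by auto
  have ne: "\<zero> \<noteq> \<one>"
    using R.le_zero_iff[of c] R.le_one[of c] c(1) c0 by auto
  have "resl_hom two_plus_two ?R ?h"
    using R.two_plus_two_hom[of c, unfolded neg_cone_simps] c[unfolded neg_cone_simps] by blast
  then have "resl_hom (K two_plus_two) (K ?R) (map_prod ?h ?h)"
    by (rule K_hom[OF resl_algebra_two_plus_two])
  then have hom: "resl_hom K8 (K ?R) (map_prod ?h ?h)"
    unfolding K8_eq by (rule resl_hom_subalgebra) (auto simp: K_def two_plus_two_def)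
  show ?thesis
  proof (rule Th_mono_hom[OF _ resl_algebra_K8 twist_hom hom])
    show "inj_on (map_prod ?h ?h) (carrier K8)"
      using ne c(2) c0 by (auto simp: K8_eq inj_on_def split: if_splits)
    have tc: "twist A \<zero> = (\<zero>, \<one>)" "twist A \<one> = (\<one>, \<one>)" "twist A c = (c, \<one>)"
    proof -
      show "twist A \<zero> = (\<zero>, \<one>)" "twist A \<one> = (\<one>, \<one>)"
        using twist_hom by (simp_all add: resl_hom_def K_def)
      have "\<one> \<preceq> c \<rightharpoonup> \<one>"
        using c(1) by (simp add: residuation[symmetric])
      then show "twist A c = (c, \<one>)"
        using c(1) by (simp add: twist_def rle_def meet_comm[of _ \<one>])
    qed
    \<comment> \<open>The residual here is that of \<open>A\<close>; in the cone it is truncated to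
      \<open>\<zero>\<close>.\<close>
    have t0c: "twist A (c \<rightharpoonup> \<zero>) = (\<zero>, c)"
    proof -
      have "twist A (c \<rightharpoonup> \<zero>) = twist A c \<rightharpoonup>\<^bsub>K ?R\<^esub> twist A \<zero>"
        using twist_hom cA by (simp add: resl_hom_def)
      also have "\<dots> = ((c \<rightharpoonup>\<^bsub>?R\<^esub> \<zero>) \<curlywedge> (\<one> \<rightharpoonup>\<^bsub>?R\<^esub> \<one>), c \<otimes> \<one>)"
        by (simp add: tc K_def)
      also have "\<dots> = (\<zero>, c)"
        using c(4) cA R.bound_simps(1)[of \<one>] R.one_in_carrier by (simp add: one_imp meet_idem)
      finally show ?thesis .
    qed
    have inv: "twist A (c \<rightharpoonup> \<one>) = (\<one>, c)" "twist A (\<zero> \<rightharpoonup> \<one>) = (\<one>, \<zero>)"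
        "twist A ((c \<rightharpoonup> \<zero>) \<rightharpoonup> \<one>) = (c, \<zero>)"
      using cA by (simp_all add: twist_neg tc t0c)
    \<comment> \<open>\<open>(c, c)\<close> is the meet of \<open>(c, \<zero>)\<close> and
      \<open>(\<one>, c)\<close>.\<close>
    have "twist A (((c \<rightharpoonup> \<zero>) \<rightharpoonup> \<one>) \<curlywedge> (c \<rightharpoonup> \<one>)) =
        twist A ((c \<rightharpoonup> \<zero>) \<rightharpoonup> \<one>) \<curlywedge>\<^bsub>K ?R\<^esub> twist A (c \<rightharpoonup> \<one>)"
      using twist_hom cA by (simp add: resl_hom_def)
    also have "\<dots> = (c, c)"
      using R.bound_simps(6)[OF c(1)] R.bound_simps(3)[OF c(1)] by (simp add: inv K_def)
    finally have cc: "twist A (((c \<rightharpoonup> \<zero>) \<rightharpoonup> \<one>) \<curlywedge> (c \<rightharpoonup> \<one>)) = (c, c)" .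
    have "{(\<zero>, \<one>), (\<one>, \<one>), (c, \<one>), (\<zero>, c), (\<one>, c), (\<one>, \<zero>), (c, \<zero>), (c, c)} \<subseteq>
        twist A ` {\<zero>, \<one>, c, c \<rightharpoonup> \<zero>, c \<rightharpoonup> \<one>, \<zero> \<rightharpoonup> \<one>, (c \<rightharpoonup> \<zero>) \<rightharpoonup> \<one>, ((c \<rightharpoonup> \<zero>) \<rightharpoonup> \<one>) \<curlywedge> (c \<rightharpoonup> \<one>)}"
      by (simp add: tc t0c inv cc)
    also have "\<dots> \<subseteq> twist A ` carrier A"
      using cA by (intro image_mono) simp
    finally show "map_prod ?h ?h ` carrier K8 \<subseteq> twist A ` carrier A"
      by (auto simp: K8_eq)
  qed unfold_locales
qed

end

lemma K_class_SRL_boolean: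
  assumes A: "A \<in> K_class SRL" and b: "boolean_eq \<in> Th {A}"
  shows "A \<in> K_class BA"
proof -
  interpret bounded_K_lattice A
    using A by (simp add: K_class_def)
  have "neg_cone A \<in> BA"
  proof (rule bcrl.BA_if_excluded_middle[OF bcrl_neg_cone])
    fix x assume "x \<in> carrier (neg_cone A)"
    then show "x \<curlyvee>\<^bsub>neg_cone A\<^esub> (x \<rightharpoonup>\<^bsub>neg_cone A\<^esub> \<zero>\<^bsub>neg_cone A\<^esub>) = \<one>\<^bsub>neg_cone A\<^esub>"
      using b unfolding boolean_eq_iff by (auto simp: boolean_eq_def rle_def)
  qed
  then show ?thesis
    using A by (simp add: K_class_def)
qed

text \<open>The case split is on the excluded middle of the cone; where it fails, finiteness
  provides the idempotent dense element.\<close>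

lemma finite_K_class_SRL_cases:
  assumes A: "A \<in> K_class SRL" and fin: "finite (carrier A)"
  shows "Th {A} \<subseteq> Th {K4} \<or> Th {A} \<subseteq> Th {K8} \<or> Th {K3} \<subseteq> Th {A}"
proof (cases "boolean_eq \<in> Th {A}")
  case True
  then show ?thesis
    using Th_le_K4_or_K3_le_Th[OF K_class_SRL_boolean[OF A]] by blast
next
  case False
  interpret bounded_K_lattice A
    using A by (simp add: K_class_def)
  let ?R = "neg_cone A"
  interpret R: bcrl ?R
    by (rule bcrl_neg_cone)
  obtain y where y: "y \<in> carrier A"
    "(y \<curlywedge>\<^bsub>A\<^esub> \<one>\<^bsub>A\<^esub>) \<curlyvee>\<^bsub>A\<^esub> ((y \<curlywedge>\<^bsub>A\<^esub> \<one>\<^bsub>A\<^esub> \<rightharpoonup>\<^bsub>A\<^esub> \<zero>\<^bsub>A\<^esub>) \<curlywedge>\<^bsub>A\<^esub> \<one>\<^bsub>A\<^esub>) \<noteq> \<one>\<^bsub>A\<^esub>"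
    using False unfolding boolean_eq_iff by (auto simp: boolean_eq_def)
  define x where "x = y \<curlywedge>\<^bsub>A\<^esub> \<one>\<^bsub>A\<^esub>"
  have x: "x \<in> carrier ?R"
    using y by (simp add: x_def meet_le2)
  have "\<exists>c. c \<in> carrier ?R \<and> c \<noteq> \<one>\<^bsub>?R\<^esub> \<and> c \<otimes>\<^bsub>?R\<^esub> c = c \<and> c \<rightharpoonup>\<^bsub>?R\<^esub> \<zero>\<^bsub>?R\<^esub> = \<zero>\<^bsub>?R\<^esub>"
  proof (rule R.idempotent_dense)
    show "finite (carrier ?R)"
      using fin by simp
    show "x \<curlyvee>\<^bsub>?R\<^esub> (x \<rightharpoonup>\<^bsub>?R\<^esub> \<zero>\<^bsub>?R\<^esub>) \<in> carrier ?R"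
      by (intro R.join_closed R.imp_closed R.zero_in_carrier x)
    show "x \<curlyvee>\<^bsub>?R\<^esub> (x \<rightharpoonup>\<^bsub>?R\<^esub> \<zero>\<^bsub>?R\<^esub>) \<noteq> \<one>\<^bsub>?R\<^esub>"
      using y(2) by (simp add: x_def)
    show "(x \<curlyvee>\<^bsub>?R\<^esub> (x \<rightharpoonup>\<^bsub>?R\<^esub> \<zero>\<^bsub>?R\<^esub>)) \<rightharpoonup>\<^bsub>?R\<^esub> \<zero>\<^bsub>?R\<^esub> = \<zero>\<^bsub>?R\<^esub>"
    proof (rule R.dense_if_not_excluded_middle[OF _ x])
      fix u assume "u \<in> carrier ?R"
      then show "(u \<rightharpoonup>\<^bsub>?R\<^esub> \<zero>\<^bsub>?R\<^esub>) \<curlyvee>\<^bsub>?R\<^esub> ((u \<rightharpoonup>\<^bsub>?R\<^esub> \<zero>\<^bsub>?R\<^esub>) \<rightharpoonup>\<^bsub>?R\<^esub> \<zero>\<^bsub>?R\<^esub>) = \<one>\<^bsub>?R\<^esub>"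
        using A by (simp only: K_class_def SRL_def mem_Collect_eq)
    qed
  qed blast
  then show ?thesis
    using Th_le_Th_K8 by auto
qed

section \<open>The bottom of the lattice of subvarieties\<close>

lemma gen_variety_antimono: "Th {J} \<subseteq> Th {G} \<Longrightarrow> \<V> {G} \<subseteq> \<V> {J}"
  by (auto simp: gen_variety_def Mod_def)

lemma Mod_eqs_le_Th: "A \<in> Mod E \<Longrightarrow> E \<subseteq> Th {A}"
  by (auto simp: Mod_def Th_def)

lemma gen_variety_le_Mod: "E \<subseteq> Th {G} \<Longrightarrow> \<V> {G} \<subseteq> Mod E"
  by (auto simp: gen_variety_def Mod_def)

lemma finite_in_gen_variety:
  assumes "infinite (UNIV :: 'a set)" "resl_algebra G" "finite (carrier G)"
  obtains A :: "'a resl" where "A \<in> \<V> {G}" "resl_algebra A" "finite (carrier A)" "Th {A} = Th {G}"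
proof -
  obtain A :: "'a resl" where A: "resl_algebra A" "finite (carrier A)" "Th {A} = Th {G}"
    using Th_isomorphic_copy[OF assms(2,3,1)] by blast
  moreover have "A \<in> \<V> {G}"
    using A gen_variety_least(2)[of "{A}"] by (simp add: gen_variety_def)
  ultimately show ?thesis
    using that by blast
qed

text \<open>Inclusion of classes reflects identities of \<open>G\<close> only if a copy of
  \<open>G\<close> occurs among the members; the infinite type guarantees one.\<close>

lemma Th_le_if_gen_variety_le:
  assumes "infinite (UNIV :: 'a set)" "resl_algebra G" "finite (carrier G)"
    and "(\<V> {G} :: 'a resl set) \<subseteq> Mod E"
  shows "E \<subseteq> Th {G}"
  using finite_in_gen_variety[OF assms(1-3)] assms(4) Mod_eqs_le_Th by (metis subsetD)

lemma finitely_generated_finite: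
  assumes "infinite (UNIV :: 'a set)" "resl_algebra G" "finite (carrier G)"
  shows "finitely_generated (\<V> {G} :: 'a resl set)"
proof -
  obtain A :: "'a resl" where "resl_algebra A" "finite (carrier A)" "Th {A} = Th {G}"
    using finite_in_gen_variety[OF assms] by blast
  then show ?thesis
    unfolding finitely_generated_def
    by (intro exI[of _ "{A}"]) (simp add: gen_variety_def)
qed

lemma finite_K: "finite (carrier K3)" "finite (carrier K4)" "finite (carrier K8)"
  by (simp_all add: K3_def K4_def K8_eq)

lemma gen_variety_le_K_class_SRL:
  assumes "Th {K two_plus_two} \<subseteq> Th {G}"
  shows "\<V> {G} \<subseteq> K_class SRL"
  using gen_variety_le_Mod[of "set K_SRL_eqs" G] assms K_SRL_eqs_K_two_plus_two Mod_K_SRL_eqs by blast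

text \<open>\<open>K8\<close> belongs to its own variety, taken over its own type, so it is a
  bounded K-lattice and the result on nontrivial ones applies.\<close>

lemma Th_K8_le_Th_K3: "Th {K8} \<subseteq> Th {K3}"
proof -
  have "K8 \<in> \<V> {K8}"
    using resl_algebra_K8 gen_variety_least(2)[of "{K8}"] by simp
  then have "K8 \<in> K_class SRL"
    using gen_variety_le_K_class_SRL[OF Th_K_two_plus_two_le_Th_K8] by blast
  then interpret bounded_K_lattice K8
    by (simp add: K_class_def)
  show ?thesis
    by (rule Th_le_Th_K3[of "(0, 1)" "(0, 2)"]) (simp_all add: K8_eq)
qed

section \<open>Atoms and covers over an infinite carrier type\<close>

context
  assumes inf: "infinite (UNIV :: 'a set)"
begin

abbreviation (input) L :: "'a resl set set"
  where "L \<equiv> subvarieties (K_class SRL)"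

abbreviation (input) V3 :: "'a resl set"
  where "V3 \<equiv> \<V> {K3}"

lemma gen_variety_in_L: "Th {K two_plus_two} \<subseteq> Th {G} \<Longrightarrow> \<V> {G} \<in> L"
  using gen_variety_le_K_class_SRL by (auto simp: subvarieties_def variety_def gen_variety_def)

lemma V3_in_L: "V3 \<in> L"
  using Th_K_two_plus_two_le_Th_K4 Th_K4_le_Th_K3 by (intro gen_variety_in_L) blast

text \<open>\<open>Mod UNIV\<close> is the variety of one-element algebras.\<close>

lemma trivial_in_L: "(Mod UNIV :: 'a resl set) \<in> L"
proof -
  have "(Mod UNIV :: 'a resl set) \<subseteq> Mod (set K_SRL_eqs)"
    by (auto simp: Mod_def)
  then show ?thesis
    using Mod_K_SRL_eqs by (auto simp: subvarieties_def variety_def)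
qed

lemma trivial_least: "X \<in> L \<Longrightarrow> Mod UNIV \<subseteq> X"
  by (auto simp: subvarieties_def variety_def Mod_def)

text \<open>A member outside the trivial variety refutes some equation; the two values are the
  distinct elements that \<open>Th_le_Th_K3\<close> asks for.\<close>

lemma V3_le_nontrivial:
  assumes X: "X \<in> L" and n: "\<not> X \<subseteq> Mod UNIV"
  shows "V3 \<subseteq> X"
proof -
  obtain E where E: "X = Mod E"
    using X by (auto simp: subvarieties_def variety_def)
  obtain A where A: "A \<in> X" "A \<notin> Mod UNIV"
    using n by blast
  then interpret bounded_K_lattice A
    using X by (auto simp: subvarieties_def K_class_def)
  have "\<exists>e. \<not> satisfies A e"
    using A resl_algebra_axioms by (auto simp: Mod_def)
  then obtain \<rho> e where \<rho>: "range \<rho> \<subseteq> carrier A" "eval A \<rho> (fst e) \<noteq> eval A \<rho> (snd e)"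
    by (auto simp: satisfies_def)
  have "Th {A} \<subseteq> Th {K3}"
    by (rule Th_le_Th_K3[OF _ _ \<rho>(2)]) (rule eval_closed[OF \<rho>(1)])+
  then have "E \<subseteq> Th {K3}"
    using A(1) Mod_eqs_le_Th unfolding E by blast
  then show ?thesis
    unfolding E by (rule gen_variety_le_Mod)
qed

lemma V3_nontrivial: "\<not> V3 \<subseteq> Mod UNIV"
proof
  assume "V3 \<subseteq> Mod UNIV"
  then have "(One, Zero) \<in> Th {K3}"
    using Th_le_if_gen_variety_le[OF inf resl_algebra_K3 finite_K(1)] by blast
  then have "\<forall>\<rho> :: nat \<Rightarrow> _. range \<rho> \<subseteq> carrier K3 \<longrightarrow> \<one>\<^bsub>K3\<^esub> = \<zero>\<^bsub>K3\<^esub>"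
    by (simp add: Th_def satisfies_def)
  from this[rule_format, of "\<lambda>n. (True, True)"] show False
    by (simp add: K3_def K4_def K_def two_def)
qed

text \<open>\<open>V3\<close> lies below every nontrivial subvariety, so nothing else can cover the
  trivial one.\<close>

lemma atom_iff: "atom L U \<longleftrightarrow> U = V3"
proof
  assume "atom L U"
  then obtain B where B: "B \<in> L" "\<And>X. X \<in> L \<Longrightarrow> B \<subseteq> X" "covers L U B"
    by (auto simp: atom_def)
  then have eq: "B = Mod UNIV"
    using trivial_in_L trivial_least by blast
  have U: "U \<in> L" "Mod UNIV \<subset> U" "\<And>X. X \<in> L \<Longrightarrow> \<not> (Mod UNIV \<subset> X \<and> X \<subset> U)"
    using B(3) unfolding eq covers_def by auto
  have "V3 \<subseteq> U"
    using U(1,2) by (intro V3_le_nontrivial) auto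
  then show "U = V3"
    using U(3)[OF V3_in_L] V3_nontrivial trivial_least[OF V3_in_L] by blast
next
  assume U: "U = V3"
  have "covers L V3 (Mod UNIV)"
    unfolding covers_def
    using V3_in_L trivial_in_L trivial_least[OF V3_in_L] V3_nontrivial V3_le_nontrivial by blast
  then show "atom L U"
    unfolding U atom_def using trivial_in_L trivial_least by blast
qed

text \<open>A subvariety not contained in \<open>\<V> {K3}\<close> has a finite member outside \<open>\<V> {K3}\<close>, to which the
  classification of finite algebras applies.\<close>

lemma subvariety_cases:
  assumes K: "resl_algebra G" "finite (carrier G)" "Th {K two_plus_two} \<subseteq> Th {G}"
    and X: "variety X" "X \<subseteq> \<V> {G}" "\<not> X \<subseteq> V3"
  shows "Th {G} \<subseteq> Th {K4} \<and> \<V> {K4} \<subseteq> X \<or> Th {G} \<subseteq> Th {K8} \<and> \<V> {K8} \<subseteq> X"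
proof -
  obtain E where E: "X = Mod E"
    using X(1) by (auto simp: variety_def)
  obtain A where A: "A \<in> X" "A \<notin> V3"
    using X(3) by blast
  have alg: "resl_algebra A" and KA: "Th {G} \<subseteq> Th {A}"
    using A(1) X(2) by (auto simp: gen_variety_def Mod_def Th_def)
  obtain e where e: "e \<in> Th {K3}" "e \<notin> Th {A}"
    using A(2) alg by (auto simp: gen_variety_def Mod_def Th_def)
  \<comment> \<open>Local finiteness of the variety of \<open>G\<close>: \<open>e\<close> already
    fails in a finite subalgebra of \<open>A\<close>.\<close>
  obtain S where S: "S \<subseteq> carrier A" "finite S" "resl_algebra (A\<lparr>carrier := S\<rparr>)"
    "e \<notin> Th {A\<lparr>carrier := S\<rparr>}"
    using finite_refuting_subalgebra[OF alg K(1,2) KA e(2)] by blast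
  let ?B = "A\<lparr>carrier := S\<rparr>"
  have AB: "Th {A} \<subseteq> Th {?B}"
    by (rule Th_mono_subalgebra[OF alg S(3,1)])
  have "set K_SRL_eqs \<subseteq> Th {?B}"
    using K_SRL_eqs_K_two_plus_two K(3) KA AB by blast
  then have "?B \<in> Mod (set K_SRL_eqs)"
    using S(3) unfolding Mod_def Th_def by blast
  then have SRL: "?B \<in> K_class SRL"
    by (rule Mod_K_SRL_eqs)
  have "\<not> Th {K3} \<subseteq> Th {?B}"
    using S(4) e(1) by blast
  then have "Th {?B} \<subseteq> Th {K4} \<or> Th {?B} \<subseteq> Th {K8}"
    using finite_K_class_SRL_cases[OF SRL] S(2) by simp
  moreover have "E \<subseteq> Th {?B}" "Th {G} \<subseteq> Th {?B}"
    using Mod_eqs_le_Th[of A E] A(1) AB KA unfolding E by simp_all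
  ultimately show ?thesis
    unfolding E using gen_variety_le_Mod[of E K4] gen_variety_le_Mod[of E K8] by (meson order_trans)
qed

text \<open>By \<open>subvariety_cases\<close>, a subvariety strictly in between would contain that
  of \<open>K4\<close>, a contradiction; the alternative with \<open>K8\<close> requires
  \<open>Th {K4} \<subseteq> Th {K8}\<close>, which \<open>boolean_eq\<close> refutes.\<close>

lemma V4_covers: "covers L (\<V> {K4}) V3"
proof -
  have "\<not> Th {K3} \<subseteq> Th {K4}" "\<not> Th {K4} \<subseteq> Th {K8}"
    using separating_eqs by auto
  moreover have "\<V> {K4} \<in> L"
    by (rule gen_variety_in_L[OF Th_K_two_plus_two_le_Th_K4])
  moreover have "V3 \<subseteq> \<V> {K4}"
    by (rule gen_variety_antimono[OF Th_K4_le_Th_K3])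
  moreover have "\<not> \<V> {K4} \<subseteq> V3"
    using calculation(1) Th_le_if_gen_variety_le[OF inf resl_algebra_K4 finite_K(2)]
    unfolding gen_variety_def[of "{K3}"] by blast
  moreover have "\<V> {K4} \<subseteq> X" if "X \<in> L" "V3 \<subset> X" "X \<subset> \<V> {K4}" for X
    using subvariety_cases[OF resl_algebra_K4 finite_K(2) Th_K_two_plus_two_le_Th_K4, of X] that
      calculation(2) by (auto simp: subvarieties_def)
  ultimately show ?thesis
    unfolding covers_def using V3_in_L by blast
qed

text \<open>Symmetric to \<open>V4_covers\<close>, with \<open>no_double_zero_eq\<close> excluding
  the alternative with \<open>K4\<close>.\<close>

lemma V8_covers: "covers L (\<V> {K8}) V3"
proof -
  have "\<not> Th {K3} \<subseteq> Th {K8}" "\<not> Th {K8} \<subseteq> Th {K4}"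
    using separating_eqs Th_K4_le_Th_K3 by auto
  moreover have "\<V> {K8} \<in> L"
    by (rule gen_variety_in_L[OF Th_K_two_plus_two_le_Th_K8])
  moreover have "V3 \<subseteq> \<V> {K8}"
    by (rule gen_variety_antimono[OF Th_K8_le_Th_K3])
  moreover have "\<not> \<V> {K8} \<subseteq> V3"
    using calculation(1) Th_le_if_gen_variety_le[OF inf resl_algebra_K8 finite_K(3)]
    unfolding gen_variety_def[of "{K3}"] by blast
  moreover have "\<V> {K8} \<subseteq> X" if "X \<in> L" "V3 \<subset> X" "X \<subset> \<V> {K8}" for X
    using subvariety_cases[OF resl_algebra_K8 finite_K(3) Th_K_two_plus_two_le_Th_K8, of X] that
      calculation(2) by (auto simp: subvarieties_def)
  ultimately show ?thesis
    unfolding covers_def using V3_in_L by blast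
qed

text \<open>Some finite generator lies outside \<open>V3\<close>, so the classification puts the
  variety of \<open>K4\<close> or \<open>K8\<close> inside \<open>V\<close>. Both lie properly above
  \<open>V3\<close>, so covering forces equality.\<close>

lemma finitely_generated_cover_cases:
  assumes fg: "finitely_generated V" and cov: "covers L V V3"
  shows "V = \<V> {K4} \<or> V = \<V> {K8}"
proof -
  obtain C :: "'a resl set" where C: "finite C" "\<And>A. A \<in> C \<Longrightarrow> resl_algebra A \<and> finite (carrier A)"
    "V = \<V> C"
    using fg by (auto simp: finitely_generated_def)
  have V: "V \<in> L" "V3 \<subset> V" "\<And>X. X \<in> L \<Longrightarrow> \<not> (V3 \<subset> X \<and> X \<subset> V)"
    using cov by (auto simp: covers_def)
  have "\<not> C \<subseteq> V3"
    using gen_variety_least(3)[of C V3] C(2,3) V(2) by (auto simp: variety_def gen_variety_def)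
  then obtain A where A: "A \<in> C" "A \<notin> V3"
    by blast
  have AV: "A \<in> V"
    using gen_variety_least(2)[of C] C(2,3) A(1) by blast
  have "\<not> Th {K3} \<subseteq> Th {A}"
    using A C(2) by (auto simp: gen_variety_def Mod_def Th_def)
  moreover have "A \<in> K_class SRL"
    using AV V(1) by (auto simp: subvarieties_def)
  ultimately have A48: "Th {A} \<subseteq> Th {K4} \<or> Th {A} \<subseteq> Th {K8}"
    using finite_K_class_SRL_cases[of A] A(1) C(2) by blast
  obtain E where E: "V = Mod E"
    using V(1) by (auto simp: subvarieties_def variety_def)
  have "E \<subseteq> Th {A}"
    using AV Mod_eqs_le_Th[of A E] unfolding E by simp
  then have "\<V> {K4} \<subseteq> V \<or> \<V> {K8} \<subseteq> V"
    unfolding E using A48 gen_variety_le_Mod[of E K4] gen_variety_le_Mod[of E K8] by (meson order_trans)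
  then show ?thesis
    using V(3)[of "\<V> {K4}"] V(3)[of "\<V> {K8}"] V4_covers V8_covers by (auto simp: covers_def)
qed

end

text \<open>\<open>boolean_eq\<close> holds in \<open>K4\<close> and forces a Boolean cone;
  conversely, homomorphisms to \<open>K4\<close> separate points over a Boolean cone.\<close>

lemma gen_variety_K4_eq: "\<V> {K4} = K_class BA"
proof
  show "\<V> {K4} \<subseteq> K_class BA"
  proof
    fix A assume A: "A \<in> \<V> {K4}"
    then have "boolean_eq \<in> Th {A}"
      using separating_eqs(1) Mod_eqs_le_Th by (auto simp: gen_variety_def)
    then show "A \<in> K_class BA"
      using A gen_variety_le_K_class_SRL[OF Th_K_two_plus_two_le_Th_K4] K_class_SRL_boolean by blast
  qed
  show "K_class BA \<subseteq> \<V> {K4}"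
  proof
    fix A assume A: "A \<in> K_class BA"
    then have "resl_algebra A"
      by (simp add: K_class_def bounded_K_lattice_def comm_res_lattice_def)
    then show "A \<in> \<V> {K4}"
      using Th_K4_le[OF A] by (auto simp: gen_variety_def Mod_def Th_def)
  qed
qed

theorem theorem3p12:
  assumes "infinite (UNIV :: 'a set)"
  shows "{V. finitely_generated V \<and> almost_minimal (subvarieties (K_class SRL :: 'a resl set)) V}
      = {\<V> {K4}, \<V> {K8}}
    \<and> (\<V> {K4} :: 'a resl set) = K_class BA"
proof
  \<comment> \<open>As \<open>\<V> {K3}\<close> is the only atom, almost minimal means covering
    it.\<close>
  have "almost_minimal (subvarieties (K_class SRL :: 'a resl set)) V \<longleftrightarrow>
      covers (subvarieties (K_class SRL)) V (\<V> {K3})" for V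
    by (simp add: almost_minimal_def atom_iff[OF assms])
  then show "{V. finitely_generated V \<and> almost_minimal (subvarieties (K_class SRL :: 'a resl set)) V}
      = {\<V> {K4}, \<V> {K8}}"
    using finitely_generated_cover_cases[OF assms] V4_covers[OF assms] V8_covers[OF assms]
      finitely_generated_finite[OF assms resl_algebra_K4 finite_K(2)]
      finitely_generated_finite[OF assms resl_algebra_K8 finite_K(3)]
    by auto
  show "(\<V> {K4} :: 'a resl set) = K_class BA"
    by (rule gen_variety_K4_eq)
qed

end
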